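(* Let $(W_1,I_1)$ and $(W_2,I_2)$ be Coxeter groups and let $c=(J_1,J_2,\delta)$, $c'=(J'_1,J'_2,\delta')$ be admissible triples for $W_1\times W_2$. Let $(w_1, w_2) \in {}^{J'_1} W_1 \times W_2^{J_2}$ and let $\mathcal O$ be a double coset in $W_{c'} \backslash [w_1, w_2, c, c']/W_c$. Let $\mathcal O'$ be the $\sigma$-twisted conjugacy class of $W_{I(w_1, w_2, c, c')}$ corresponding to $\mathcal O$, i.e. $\mathcal O'=\{v\in W_{I(w_1,w_2,c,c')};\ (w_1v,w_2)\in\mathcal O\}$, where $\sigma(w)=\delta^{-1}\bigl(w_2^{-1}\delta'(w_1ww_1^{-1})w_2\bigr)$. Let $\mathcal O_{\min}$ and $\mathcal O'_{\min}$ be the sets of minimal length elements in $\mathcal O$ and $\mathcal O'$. Then (1) For each $\mathbf w \in \mathcal O$, there exists $v \in \mathcal O'$ such that $\mathbf w \rightarrow_{c, c'} (w_1 v, w_2)$. (2) If $\mathbf w \in \mathcal O_{\min}$, then there exists $v \in \mathcal O'_{\min}$ such that $\mathbf w \approx_{c, c'} (w_1 v, w_2)$.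
   Context: Coxeter groups $(W,I)$ have finite $I$; subsets of $I$ are identified with sets of simple reflections, $W_J$ is the standard parabolic subgroup generated by $J$, $W^J$ (resp. ${}^JW$) is the set of minimal length representatives of $W/W_J$ (resp. $W_J\backslash W$), and for $w\in W$, $w(K)=wKw^{-1}$. For an automorphism $\sigma$ of a group, the $\sigma$-twisted conjugacy classes are the orbits of $x\cdot y=xy\sigma(x)^{-1}$. An admissible triple for $W_1\times W_2$ is $c=(J_1,J_2,\delta)$ with $J_1\subset I_1$, $J_2\subset I_2$ and $\delta:W_{J_1}\to W_{J_2}$ a group isomorphism with $\delta(J_1)=J_2$. Set $W_c=\{(w,\delta(w)); w\in W_{J_1}\}\subset W_1\times W_2$. For $(w_1,w_2)\in {}^{J'_1}W_1\times W_2^{J_2}$, $I(w_1,w_2,c,c')$ is the largest subset $K\subset J_1$ such that $w_1(K)\subset J'_1$ and $\delta'(w_1(K))=w_2(\delta(K))$. Also $[w_1,w_2,c,c']=W_{c'}\,(w_1W_{I(w_1,w_2,c,c')}\times\{w_2\})\,W_c\subset W_1\times W_2$, a union of double cosets. The map $v\mapsto(w_1v,w_2)$ induces a bijection from the $\sigma$-twisted conjugacy classes of $W_{I(w_1,w_2,c,c')}$ to $W_{c'}\backslash[w_1,w_2,c,c']/W_c$. Let $l_1,l_2$ be the length functions of $W_1,W_2$; the length on $W_1\times W_2$ is $l(x_1,x_2)=l_1(x_1)+l_2(x_2)$. For $\mathbf w,\mathbf w'\in W_1\times W_2$: write $\mathbf w\xrightarrow{s_{-i}}_{c,c'}\mathbf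 w'$ (for $i\in J'_1$) if $\mathbf w=(s_i,\delta'(s_i))\mathbf w'$ and $l(\mathbf w')\le l(\mathbf w)$; write $\mathbf w\xrightarrow{s_j}_{c,c'}\mathbf w'$ (for $j\in J_1$) if $\mathbf w=\mathbf w'(s_j,\delta(s_j))$ and $l(\mathbf w')\le l(\mathbf w)$. Write $\mathbf w\rightarrow_{c,c'}\mathbf w'$ if there is a finite sequence from $\mathbf w$ to $\mathbf w'$ in which each consecutive pair is related by one of these elementary relations. Write $\mathbf w\sim_{c,c'}\mathbf w'$ if there is a sequence $\mathbf w=\mathbf w_0,\dots,\mathbf w_n=\mathbf w'$ and elements $x_k\in W_{J'_1}$, $y_k\in W_{J_1}$ such that for all $k$: $l(\mathbf w_{k+1})=l(\mathbf w_k)$, $\mathbf w_{k+1}=(x_k,\delta'(x_k))\mathbf w_k(y_k,\delta(y_k))$, and either $l\bigl((x_k,1)\mathbf w_k(1,\delta(y_k))\bigr)=l_1(x_k)+l(\mathbf w_k)+l_1(y_k)$ or $l\bigl((1,\delta'(x_k))\mathbf w_k(y_k,1)\bigr)=l_1(x_k)+l(\mathbf w_k)+l_1(y_k)$. Write $\mathbf w\approx_{c,c'}\mathbf w'$ if both $\mathbf w\rightarrow_{c,c'}\mathbf w'$ and $\mathbf w\sim_{c,c'}\mathbf w'$. *)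

theory Defs
  imports "HOL-Algebra.Multiplicative_Group" "HOL-Algebra.Generated_Groups"
begin

section \<open>Coxeter groups\<close>

text \<open>
  A Coxeter group is a pair \<open>(G, S)\<close> where the set of simple reflections \<open>S\<close> is a finite set of
  elements of order 2 of \<open>G\<close> which, together with the relations \<open>(s t)\<^sup>m = 1\<close> for
  \<open>s, t \<in> S\<close> with \<open>m\<close> the order of \<open>s t\<close> if that is finite, forms a presentation of \<open>G\<close>.

  Taking \<open>s = t\<close> gives the relation \<open>s s = 1\<close>, so that the group with this presentation is also the
  monoid with this presentation, i.e. words in \<open>S\<close> modulo insertion and deletion of relators.
  The order \<open>group.ord G x\<close> is \<open>0\<close> if \<open>x\<close> has infinite order; the relator is then the empty word.
\<close>

inductive relator_deletion :: "('a, 'm) monoid_scheme \<Rightarrow> 'a set \<Rightarrow> 'a list \<Rightarrow> 'a list \<Rightarrow> bool"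
  for G S where
  "\<lbrakk>u \<in> lists S; v \<in> lists S; s \<in> S; t \<in> S\<rbrakk> \<Longrightarrow>
    relator_deletion G S
      (u @ concat (replicate (group.ord G (s \<otimes>\<^bsub>G\<^esub> t)) [s, t]) @ v) (u @ v)"

definition word_prod :: "('a, 'm) monoid_scheme \<Rightarrow> 'a list \<Rightarrow> 'a" where
  "word_prod G ws = foldr (\<lambda>x y. x \<otimes>\<^bsub>G\<^esub> y) ws \<one>\<^bsub>G\<^esub>"

locale coxeter_group = group G for G (structure) +
  fixes S :: "'a set"
  assumes finite_gens: "finite S"
    and gens_closed: "S \<subseteq> carrier G"
    and gens_order: "s \<in> S \<Longrightarrow> ord s = 2"
    and gens_generate: "generate G S = carrier G"
    and presentation: "\<lbrakk>ws \<in> lists S; word_prod G ws = \<one>\<rbrakk> \<Longrightarrow> equivclp (relator_deletion G S) ws []"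

definition cox_length :: "('a, 'm) monoid_scheme \<Rightarrow> 'a set \<Rightarrow> 'a \<Rightarrow> nat" where
  "cox_length G S w = (LEAST n. \<exists>ws \<in> lists S. length ws = n \<and> word_prod G ws = w)"

definition minimal_elements :: "('x \<Rightarrow> nat) \<Rightarrow> 'x set \<Rightarrow> 'x set" where
  "minimal_elements l X = {x \<in> X. \<forall>y \<in> X. l x \<le> l y}"

text \<open>\<open>min_reps_right G S J\<close> is \<open>W\<^sup>J\<close> and \<open>min_reps_left G S J\<close> is \<open>\<^sup>JW\<close>.\<close>

definition min_reps_right :: "('a, 'm) monoid_scheme \<Rightarrow> 'a set \<Rightarrow> 'a set \<Rightarrow> 'a set" where
  "min_reps_right G S J =
    {w \<in> carrier G. w \<in> minimal_elements (cox_length G S) (w <#\<^bsub>G\<^esub> generate G J)}"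

definition min_reps_left :: "('a, 'm) monoid_scheme \<Rightarrow> 'a set \<Rightarrow> 'a set \<Rightarrow> 'a set" where
  "min_reps_left G S J =
    {w \<in> carrier G. w \<in> minimal_elements (cox_length G S) (generate G J #>\<^bsub>G\<^esub> w)}"

definition conj_elt :: "('a, 'm) monoid_scheme \<Rightarrow> 'a \<Rightarrow> 'a \<Rightarrow> 'a" where
  "conj_elt G w x = w \<otimes>\<^bsub>G\<^esub> x \<otimes>\<^bsub>G\<^esub> inv\<^bsub>G\<^esub> w"

definition twisted_classes :: "('a, 'm) monoid_scheme \<Rightarrow> 'a set \<Rightarrow> ('a \<Rightarrow> 'a) \<Rightarrow> 'a set set" where
  "twisted_classes G H \<sigma> =
    {{x \<otimes>\<^bsub>G\<^esub> y \<otimes>\<^bsub>G\<^esub> inv\<^bsub>G\<^esub> (\<sigma> x) | x. x \<in> H} | y. y \<in> H}"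


section \<open>Admissible triples\<close>

text \<open>
  The triple \<open>c = (J\<^sub>1, J\<^sub>2, \<delta>)\<close> has \<open>src c = J\<^sub>1\<close>, \<open>tgt c = J\<^sub>2\<close> and \<open>dia c = \<delta>\<close>.
  The values of \<open>dia c\<close> outside the parabolic subgroup generated by \<open>src c\<close> are irrelevant.
\<close>

record ('a, 'b) triple =
  src :: "'a set"
  tgt :: "'b set"
  dia :: "'a \<Rightarrow> 'b"

definition admissible_triple ::
  "('a, 'm) monoid_scheme \<Rightarrow> 'a set \<Rightarrow> ('b, 'n) monoid_scheme \<Rightarrow> 'b set \<Rightarrow> ('a, 'b) triple \<Rightarrow> bool"
where
  "admissible_triple W1 I1 W2 I2 c \<longleftrightarrow>
    src c \<subseteq> I1 \<and> tgt c \<subseteq> I2 \<and>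
    dia c \<in> iso (W1\<lparr>carrier := generate W1 (src c)\<rparr>) (W2\<lparr>carrier := generate W2 (tgt c)\<rparr>) \<and>
    dia c ` src c = tgt c"

definition graph_subgroup :: "('a, 'm) monoid_scheme \<Rightarrow> ('a, 'b) triple \<Rightarrow> ('a \<times> 'b) set" where
  "graph_subgroup W1 c = {(w, dia c w) | w. w \<in> generate W1 (src c)}"

text \<open>
  \<open>stable_subset\<close> is \<open>I(w\<^sub>1, w\<^sub>2, c, c')\<close>, a largest element for inclusion (the defining condition is
  preserved by unions), \<open>piece\<close> is \<open>[w\<^sub>1, w\<^sub>2, c, c']\<close>, and \<open>twist\<close> is the automorphism \<open>\<sigma>\<close>
  of \<open>stable_parabolic\<close>.
\<close>

definition stable_subset ::
  "('a, 'm) monoid_scheme \<Rightarrow> ('b, 'n) monoid_scheme \<Rightarrow> 'a \<Rightarrow> 'b \<Rightarrow>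
    ('a, 'b) triple \<Rightarrow> ('a, 'b) triple \<Rightarrow> 'a set"
where
  "stable_subset W1 W2 w1 w2 c c' =
    (GREATEST K. K \<subseteq> src c \<and> conj_elt W1 w1 ` K \<subseteq> src c' \<and>
      dia c' ` conj_elt W1 w1 ` K = conj_elt W2 w2 ` dia c ` K)"

definition stable_parabolic ::
  "('a, 'm) monoid_scheme \<Rightarrow> ('b, 'n) monoid_scheme \<Rightarrow> 'a \<Rightarrow> 'b \<Rightarrow>
    ('a, 'b) triple \<Rightarrow> ('a, 'b) triple \<Rightarrow> 'a set"
where
  "stable_parabolic W1 W2 w1 w2 c c' = generate W1 (stable_subset W1 W2 w1 w2 c c')"

definition piece ::
  "('a, 'm) monoid_scheme \<Rightarrow> ('b, 'n) monoid_scheme \<Rightarrow> 'a \<Rightarrow> 'b \<Rightarrow>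
    ('a, 'b) triple \<Rightarrow> ('a, 'b) triple \<Rightarrow> ('a \<times> 'b) set"
where
  "piece W1 W2 w1 w2 c c' =
    graph_subgroup W1 c'
      <#>\<^bsub>W1 \<times>\<times> W2\<^esub> ((w1 <#\<^bsub>W1\<^esub> stable_parabolic W1 W2 w1 w2 c c') \<times> {w2})
      <#>\<^bsub>W1 \<times>\<times> W2\<^esub> graph_subgroup W1 c"

text \<open>The set of double cosets \<open>H \ X / K\<close> contained in a union \<open>X\<close> of double cosets.\<close>

definition double_cosets ::
  "('x, 'm) monoid_scheme \<Rightarrow> 'x set \<Rightarrow> 'x set \<Rightarrow> 'x set \<Rightarrow> 'x set set"
where
  "double_cosets G H X K = {H <#>\<^bsub>G\<^esub> {x} <#>\<^bsub>G\<^esub> K | x. x \<in> X}"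

definition twist ::
  "('a, 'm) monoid_scheme \<Rightarrow> ('b, 'n) monoid_scheme \<Rightarrow> 'a \<Rightarrow> 'b \<Rightarrow>
    ('a, 'b) triple \<Rightarrow> ('a, 'b) triple \<Rightarrow> 'a \<Rightarrow> 'a"
where
  "twist W1 W2 w1 w2 c c' w =
    inv_into (generate W1 (src c)) (dia c)
      (inv\<^bsub>W2\<^esub> w2 \<otimes>\<^bsub>W2\<^esub> dia c' (w1 \<otimes>\<^bsub>W1\<^esub> w \<otimes>\<^bsub>W1\<^esub> inv\<^bsub>W1\<^esub> w1) \<otimes>\<^bsub>W2\<^esub> w2)"


section \<open>Relations on the product\<close>

text \<open>
  \<open>reduces_to\<close>, \<open>strongly_conj\<close> and \<open>approx_conj\<close> are the relations \<open>\<rightarrow>\<close>, \<open>\<sim>\<close> and \<open>\<approx>\<close> for \<open>c, c'\<close>.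
  Only one of the two elements is required to lie in the carrier, since the other one then does.
\<close>

definition prod_length ::
  "('a, 'm) monoid_scheme \<Rightarrow> 'a set \<Rightarrow> ('b, 'n) monoid_scheme \<Rightarrow> 'b set \<Rightarrow> 'a \<times> 'b \<Rightarrow> nat"
where
  "prod_length W1 I1 W2 I2 w = cox_length W1 I1 (fst w) + cox_length W2 I2 (snd w)"

inductive elementary_reduction ::
  "('a, 'm) monoid_scheme \<Rightarrow> 'a set \<Rightarrow> ('b, 'n) monoid_scheme \<Rightarrow> 'b set \<Rightarrow>
    ('a, 'b) triple \<Rightarrow> ('a, 'b) triple \<Rightarrow> 'a \<times> 'b \<Rightarrow> 'a \<times> 'b \<Rightarrow> bool"
  for W1 I1 W2 I2 c c' where
  left: "\<lbrakk>w' \<in> carrier (W1 \<times>\<times> W2); i \<in> src c'; w = (i, dia c' i) \<otimes>\<^bsub>W1 \<times>\<times> W2\<^esub> w';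
      prod_length W1 I1 W2 I2 w' \<le> prod_length W1 I1 W2 I2 w\<rbrakk>
    \<Longrightarrow> elementary_reduction W1 I1 W2 I2 c c' w w'"
| right: "\<lbrakk>w' \<in> carrier (W1 \<times>\<times> W2); j \<in> src c; w = w' \<otimes>\<^bsub>W1 \<times>\<times> W2\<^esub> (j, dia c j);
      prod_length W1 I1 W2 I2 w' \<le> prod_length W1 I1 W2 I2 w\<rbrakk>
    \<Longrightarrow> elementary_reduction W1 I1 W2 I2 c c' w w'"

definition reduces_to ::
  "('a, 'm) monoid_scheme \<Rightarrow> 'a set \<Rightarrow> ('b, 'n) monoid_scheme \<Rightarrow> 'b set \<Rightarrow>
    ('a, 'b) triple \<Rightarrow> ('a, 'b) triple \<Rightarrow> 'a \<times> 'b \<Rightarrow> 'a \<times> 'b \<Rightarrow> bool"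
where
  "reduces_to W1 I1 W2 I2 c c' = (elementary_reduction W1 I1 W2 I2 c c')\<^sup>*\<^sup>*"

inductive elementary_strong_conj ::
  "('a, 'm) monoid_scheme \<Rightarrow> 'a set \<Rightarrow> ('b, 'n) monoid_scheme \<Rightarrow> 'b set \<Rightarrow>
    ('a, 'b) triple \<Rightarrow> ('a, 'b) triple \<Rightarrow> 'a \<times> 'b \<Rightarrow> 'a \<times> 'b \<Rightarrow> bool"
  for W1 I1 W2 I2 c c' where
  "\<lbrakk>w \<in> carrier (W1 \<times>\<times> W2); x \<in> generate W1 (src c'); y \<in> generate W1 (src c);
    prod_length W1 I1 W2 I2 w' = prod_length W1 I1 W2 I2 w;
    w' = (x, dia c' x) \<otimes>\<^bsub>W1 \<times>\<times> W2\<^esub> w \<otimes>\<^bsub>W1 \<times>\<times> W2\<^esub> (y, dia c y);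
    prod_length W1 I1 W2 I2 ((x, \<one>\<^bsub>W2\<^esub>) \<otimes>\<^bsub>W1 \<times>\<times> W2\<^esub> w \<otimes>\<^bsub>W1 \<times>\<times> W2\<^esub> (\<one>\<^bsub>W1\<^esub>, dia c y)) =
      cox_length W1 I1 x + prod_length W1 I1 W2 I2 w + cox_length W1 I1 y \<or>
    prod_length W1 I1 W2 I2 ((\<one>\<^bsub>W1\<^esub>, dia c' x) \<otimes>\<^bsub>W1 \<times>\<times> W2\<^esub> w \<otimes>\<^bsub>W1 \<times>\<times> W2\<^esub> (y, \<one>\<^bsub>W2\<^esub>)) =
      cox_length W1 I1 x + prod_length W1 I1 W2 I2 w + cox_length W1 I1 y\<rbrakk>
  \<Longrightarrow> elementary_strong_conj W1 I1 W2 I2 c c' w w'"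

definition strongly_conj ::
  "('a, 'm) monoid_scheme \<Rightarrow> 'a set \<Rightarrow> ('b, 'n) monoid_scheme \<Rightarrow> 'b set \<Rightarrow>
    ('a, 'b) triple \<Rightarrow> ('a, 'b) triple \<Rightarrow> 'a \<times> 'b \<Rightarrow> 'a \<times> 'b \<Rightarrow> bool"
where
  "strongly_conj W1 I1 W2 I2 c c' = (elementary_strong_conj W1 I1 W2 I2 c c')\<^sup>*\<^sup>*"

definition approx_conj ::
  "('a, 'm) monoid_scheme \<Rightarrow> 'a set \<Rightarrow> ('b, 'n) monoid_scheme \<Rightarrow> 'b set \<Rightarrow>
    ('a, 'b) triple \<Rightarrow> ('a, 'b) triple \<Rightarrow> 'a \<times> 'b \<Rightarrow> 'a \<times> 'b \<Rightarrow> bool"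
where
  "approx_conj W1 I1 W2 I2 c c' w w' \<longleftrightarrow>
    reduces_to W1 I1 W2 I2 c c' w w' \<and> strongly_conj W1 I1 W2 I2 c c' w w'"

end

theory Submission
  imports Defs
begin

text \<open>
  Given \<open>(a, b)\<close>, write \<open>b = b' q\<close> with \<open>b' \<in> W\<^sub>2\<^sup>J\<close> and \<open>q \<in> W\<^sub>J\<close> for \<open>J = tgt c\<close>. Removing \<open>q\<close> letter
  by letter shortens the second component by one in each step and lengthens the first by at most
  one; symmetrically on the left. Alternating the two normalisations on
  \<open>(x w\<^sub>1 v y, \<delta>'(x) w\<^sub>2 \<delta>(y))\<close> confines \<open>x\<close> to a decreasing sequence of standard parabolic
  subgroups, because by Deodhar's lemma a letter passing through a minimal representative either
  lengthens it or reappears as a simple reflection on the other side. When the sequence becomes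
  stationary, comparing ranks shows that its last term is
  generated by \<open>w\<^sub>1(I(w\<^sub>1, w\<^sub>2, c, c'))\<close>; then \<open>x\<close> can be moved across \<open>(w\<^sub>1, w\<^sub>2)\<close> and be absorbed
  into \<open>v\<close>. On minimal length elements no reduction step changes the length, and an elementary
  step of equal length is a strong conjugation since it lengthens exactly one of the components.
\<close>

section \<open>Words and the exchange condition\<close>

context group
begin

lemma word_prod_Nil [simp]: "word_prod G [] = \<one>"
  by (simp add: word_prod_def)

lemma word_prod_Cons [simp]: "word_prod G (s # ws) = s \<otimes> word_prod G ws"
  by (simp add: word_prod_def)

lemma word_prod_closed [simp, intro]:
  "ws \<in> lists (carrier G) \<Longrightarrow> word_prod G ws \<in> carrier G"
  by (induction ws) auto

lemma word_prod_append:
  "\<lbrakk>u \<in> lists (carrier G); v \<in> lists (carrier G)\<rbrakk> \<Longrightarrow>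
    word_prod G (u @ v) = word_prod G u \<otimes> word_prod G v"
  by (induction u) (auto simp: m_assoc)

lemma word_prod_rev:
  assumes "ws \<in> lists (carrier G)" "\<And>s. s \<in> set ws \<Longrightarrow> s \<otimes> s = \<one>"
  shows "word_prod G (rev ws) = inv (word_prod G ws)"
  using assms
proof (induction ws rule: list.induct)
  case (Cons s ws)
  have s: "s \<in> carrier G" and ws: "ws \<in> lists (carrier G)" and "s \<otimes> s = \<one>"
    using Cons.prems(1) Cons.prems(2)[of s] by auto
  then have "inv s = s" by (simp add: inv_equality)
  moreover have "rev ws \<in> lists (carrier G)" using ws by auto
  ultimately show ?case
    using Cons.IH[OF ws] Cons.prems(2) s ws by (simp add: word_prod_append inv_mult_group)
qed simp

text \<open>Each generator is its own inverse, so inverse letters never have to be written.\<close>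

lemma generate_eq_word_prods:
  assumes "J \<subseteq> carrier G" "\<And>s. s \<in> J \<Longrightarrow> s \<otimes> s = \<one>"
  shows "generate G J = word_prod G ` lists J"
proof
  have lists: "lists J \<subseteq> lists (carrier G)" using assms(1) by auto
  have invJ: "inv s = s" if "s \<in> J" for s
    using that assms by (metis inv_equality subsetD)
  show "generate G J \<subseteq> word_prod G ` lists J"
  proof
    fix x assume "x \<in> generate G J"
    then show "x \<in> word_prod G ` lists J"
    proof (induction rule: generate.induct)
      case one
      show ?case by (rule image_eqI[of _ _ "[]"]) auto
    next
      case (incl h)
      then show ?case using assms(1) by (intro image_eqI[of _ _ "[h]"]) auto
    next
      case (inv h)
      then show ?case using assms(1) invJ by (intro image_eqI[of _ _ "[h]"]) auto
    next
      case (eng h1 h2)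
      then obtain u v where uv: "u \<in> lists J" "v \<in> lists J"
        and h: "h1 = word_prod G u" "h2 = word_prod G v"
        by blast
      then have "h1 \<otimes> h2 = word_prod G (u @ v)"
        using lists by (simp add: word_prod_append subset_iff)
      then show ?case using uv by (intro image_eqI[of _ _ "u @ v"]) auto
    qed
  qed
  show "word_prod G ` lists J \<subseteq> generate G J"
  proof (rule image_subsetI)
    fix ws assume "ws \<in> lists J"
    then show "word_prod G ws \<in> generate G J"
      by (induction ws) (auto intro: generate.intros)
  qed
qed

text \<open>
  \<open>odd_refl ws r\<close>: among the elements \<open>s\<^sub>1 \<cdots> s\<^sub>i \<cdots> s\<^sub>1\<close> obtained from the prefixes of the word
  \<open>ws = s\<^sub>1 \<cdots> s\<^sub>n\<close>, the number of those equal to \<open>r\<close> is odd.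
\<close>

fun odd_refl :: "'a list \<Rightarrow> 'a \<Rightarrow> bool" where
  "odd_refl [] r = False"
| "odd_refl (s # ws) r = ((r = s) \<noteq> odd_refl ws (s \<otimes> r \<otimes> s))"

text \<open>The reflections that \<open>v\<close> contributes inside \<open>u @ v\<close> are those
  of \<open>v\<close> conjugated by the product of \<open>u\<close>. Counts add, and \<noteq> on
  booleans is addition of parities.\<close>

lemma odd_refl_append:
  assumes "u \<in> lists (carrier G)" "\<And>s. s \<in> set u \<Longrightarrow> s \<otimes> s = \<one>" "r \<in> carrier G"
  shows "odd_refl (u @ v) r =
    (odd_refl u r \<noteq> odd_refl v (inv (word_prod G u) \<otimes> r \<otimes> word_prod G u))"
  using assms
proof (induction u arbitrary: r rule: list.induct)
  case (Cons s u)
  have s: "s \<in> carrier G" and u: "u \<in> lists (carrier G)" and ss: "s \<otimes> s = \<one>"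
    using Cons.prems(1) Cons.prems(2)[of s] by auto
  then have "inv s = s" by (simp add: inv_equality)
  then show ?case
    using Cons.IH[OF u, of "s \<otimes> r \<otimes> s"] Cons.prems s u
    by (auto simp: inv_mult_group m_assoc)
qed simp

text \<open>An odd count is nonzero, so \<open>r\<close> equals some
  \<open>s\<^sub>1 \<cdots> s\<^sub>i \<cdots> s\<^sub>1\<close>; multiplying by it on the left
  deletes the letter \<open>s\<^sub>i\<close>.\<close>

lemma odd_refl_split:
  assumes "ws \<in> lists (carrier G)" "\<And>s. s \<in> set ws \<Longrightarrow> s \<otimes> s = \<one>" "r \<in> carrier G"
    and "odd_refl ws r"
  shows "\<exists>u s v. ws = u @ s # v \<and> r \<otimes> word_prod G ws = word_prod G (u @ v)"
  using assms
proof (induction ws arbitrary: r rule: list.induct)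
  case (Cons s ws)
  have s: "s \<in> carrier G" and ws: "ws \<in> lists (carrier G)" and ss: "s \<otimes> s = \<one>"
    using Cons.prems(1) Cons.prems(2)[of s] by auto
  have cancel: "s \<otimes> (s \<otimes> x) = x" if "x \<in> carrier G" for x
    using ss s that m_assoc[of s s x] by simp
  show ?case
  proof (cases "r = s")
    case True
    have "s # ws = [] @ s # ws" by simp
    moreover have "r \<otimes> word_prod G (s # ws) = word_prod G ([] @ ws)"
      using True ws cancel by simp
    ultimately show ?thesis by blast
  next
    case False
    then obtain u x v where e: "ws = u @ x # v"
      "(s \<otimes> r \<otimes> s) \<otimes> word_prod G ws = word_prod G (u @ v)"
      using Cons.IH[OF ws, of "s \<otimes> r \<otimes> s"] Cons.prems s by auto
    have "s \<otimes> (r \<otimes> (s \<otimes> word_prod G ws)) = word_prod G (u @ v)"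
      using e(2) s ws Cons.prems(3) by (simp add: m_assoc)
    then have "r \<otimes> word_prod G (s # ws) = word_prod G ((s # u) @ v)"
      using cancel[of "r \<otimes> (s \<otimes> word_prod G ws)"] s ws Cons.prems(3) by simp
    moreover have "s # ws = (s # u) @ x # v" using e by simp
    ultimately show ?thesis by blast
  qed
qed simp

text \<open>In the word s t s t ... the prefix of length i + 1 gives the reflection (s t)^i s, so
  the parity becomes a count over exponents.\<close>

lemma odd_refl_alternating:
  assumes s: "s \<in> carrier G" "s \<otimes> s = \<one>" and t: "t \<in> carrier G" "t \<otimes> t = \<one>"
    and "r \<in> carrier G"
  shows "odd_refl (concat (replicate k [s, t])) r =
    odd (\<Sum>i<2 * k. of_bool (r = (s \<otimes> t) [^] i \<otimes> s) :: nat)"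
  using \<open>r \<in> carrier G\<close>
proof (induction k arbitrary: r)
  case (Suc k)
  define c where "c = s \<otimes> t"
  have c: "c \<in> carrier G" using s t by (simp add: c_def)
  have is_s: "inv s = s" and it: "inv t = t" using s t by (simp_all add: inv_equality)
  have ic: "inv c = t \<otimes> s" using s t is_s it by (simp add: c_def inv_mult_group)
  have ss: "s \<otimes> (s \<otimes> x) = x" if "x \<in> carrier G" for x
    using s that m_assoc[of s s x] by simp
  have tt: "t \<otimes> (t \<otimes> x) = x" if "x \<in> carrier G" for x
    using t that m_assoc[of t t x] by simp
  let ?r = "t \<otimes> (s \<otimes> r \<otimes> s) \<otimes> t"
  have r: "r \<in> carrier G" by fact
  have rc: "?r \<in> carrier G" using s t r by simp
  have 1: "(s \<otimes> r \<otimes> s = t) = (r = c [^] Suc 0 \<otimes> s)"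
  proof
    assume "s \<otimes> r \<otimes> s = t"
    then have "s \<otimes> (s \<otimes> r \<otimes> s) \<otimes> s = s \<otimes> t \<otimes> s" by simp
    then show "r = c [^] Suc 0 \<otimes> s" using s t r c ss by (simp add: c_def m_assoc)
  next
    assume "r = c [^] Suc 0 \<otimes> s"
    then show "s \<otimes> r \<otimes> s = t" using s t r c ss by (simp add: c_def m_assoc)
  qed
  \<comment> \<open>Removing the first two letters shifts the exponent by two: conjugating c^i s by
    c gives c^(i+1) s t s = c^(i+2) s.\<close>
  have 2: "(?r = c [^] i \<otimes> s) = (r = c [^] Suc (Suc i) \<otimes> s)" for i
  proof -
    have e: "?r = inv c \<otimes> r \<otimes> c" unfolding ic using s t r by (simp add: c_def m_assoc)
    have "c \<otimes> (c [^] i \<otimes> s) \<otimes> inv c = c \<otimes> c [^] i \<otimes> c \<otimes> s"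
      using c s t ss by (simp add: ic m_assoc) (simp add: c_def m_assoc)
    also have "\<dots> = c [^] Suc (Suc i) \<otimes> s"
      using c s by (metis nat_pow_Suc nat_pow_Suc2)
    finally have f: "c \<otimes> (c [^] i \<otimes> s) \<otimes> inv c = c [^] Suc (Suc i) \<otimes> s" .
    show ?thesis
    proof
      assume "?r = c [^] i \<otimes> s"
      then have "c \<otimes> (inv c \<otimes> r \<otimes> c) \<otimes> inv c = c [^] Suc (Suc i) \<otimes> s" using e f by simp
      then show "r = c [^] Suc (Suc i) \<otimes> s"
        using c r by (simp add: m_assoc[symmetric]) (simp add: m_assoc)
    next
      assume "r = c [^] Suc (Suc i) \<otimes> s"
      then have "r = c \<otimes> (c [^] i \<otimes> s) \<otimes> inv c" using f by simp
      then have "inv c \<otimes> r \<otimes> c = c [^] i \<otimes> s"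
        using c s by (simp add: m_assoc inv_solve_left')
      then show "?r = c [^] i \<otimes> s" using e by simp
    qed
  qed
  have "odd_refl (concat (replicate (Suc k) [s, t])) r =
    ((r = s) \<noteq> ((s \<otimes> r \<otimes> s = t) \<noteq> odd_refl (concat (replicate k [s, t])) ?r))" by simp
  also have "\<dots> = ((r = s) \<noteq> ((r = c [^] Suc 0 \<otimes> s) \<noteq>
      odd (\<Sum>i<2 * k. of_bool (r = c [^] Suc (Suc i) \<otimes> s) :: nat)))"
    unfolding 1 2[symmetric] using Suc.IH[OF rc] by (simp add: c_def)
  also have "\<dots> = odd (\<Sum>i<Suc (Suc (2 * k)). of_bool (r = c [^] i \<otimes> s) :: nat)"
    unfolding sum.lessThan_Suc_shift using s(1) by auto
  finally show ?case by (simp add: c_def)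
qed simp

end

section \<open>Parity invariants of words, the length function and the exchange condition\<close>

context coxeter_group
begin

lemma gens_in_carrier: "s \<in> S \<Longrightarrow> s \<in> carrier G"
  using gens_closed by auto

lemma gens_square: "s \<in> S \<Longrightarrow> s \<otimes> s = \<one>"
  using gens_order[of s] gens_in_carrier[of s] pow_ord_eq_1[of s]
  by (simp add: numeral_2_eq_2)

lemma gens_inv: "s \<in> S \<Longrightarrow> inv s = s"
  using gens_square gens_in_carrier by (simp add: inv_equality)

lemma gens_not_one: "s \<in> S \<Longrightarrow> s \<noteq> \<one>"
  using gens_order[of s] by (auto simp: ord_id)

lemma gens_cancel: "\<lbrakk>s \<in> S; x \<in> carrier G\<rbrakk> \<Longrightarrow> s \<otimes> (s \<otimes> x) = x"
  using gens_square gens_in_carrier m_assoc[of s s x] by simp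

lemma words_in_carrier: "ws \<in> lists S \<Longrightarrow> ws \<in> lists (carrier G)"
  using gens_closed by auto

lemma word_inv: "ws \<in> lists S \<Longrightarrow> word_prod G (rev ws) = inv (word_prod G ws)"
  by (rule word_prod_rev) (auto simp: gens_square gens_in_carrier)

text \<open>The reflections (s t)^i s of a relator are periodic in i with period m, the order of s
  t, so over its 2m letters each occurs an even number of times. The relator has product 1 and so
  does not alter the conjugation applied to the suffix. For infinite order m is 0 and the relator is
  empty.\<close>

lemma relator_deletion_odd_refl:
  assumes "relator_deletion G S a b" "r \<in> carrier G"
  shows "odd_refl a r = odd_refl b r"
  using assms(1)
proof cases
  case (1 u v s t)
  define m where "m = ord (s \<otimes> t)"
  define rel where "rel = concat (replicate m [s, t])"
  have st: "s \<in> carrier G" "t \<in> carrier G" using 1 gens_in_carrier by auto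
  have relS: "rel \<in> lists S" using 1 by (auto simp: rel_def set_replicate_conv_if split: if_splits)
  have "word_prod G (concat (replicate k [s, t])) = (s \<otimes> t) [^] k" for k
  proof (induction k)
    case (Suc k)
    have "word_prod G (concat (replicate (Suc k) [s, t])) = (s \<otimes> t) \<otimes> (s \<otimes> t) [^] k"
      using Suc st by (simp add: m_assoc)
    also have "\<dots> = (s \<otimes> t) [^] Suc k" using st by (metis m_closed nat_pow_Suc2)
    finally show ?case .
  qed simp
  then have rel1: "word_prod G rel = \<one>"
    using st by (simp add: rel_def m_def)
  have relodd: "\<not> odd_refl rel r'" if "r' \<in> carrier G" for r'
  proof -
    let ?f = "\<lambda>i. of_bool (r' = (s \<otimes> t) [^] i \<otimes> s) :: nat"
    have "(\<Sum>i<m + n. ?f i) = (\<Sum>i<m. ?f i) + (\<Sum>i<n. ?f (m + i))" for n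
      by (induction n) simp_all
    then have "(\<Sum>i<m + m. ?f i) = (\<Sum>i<m. ?f i) + (\<Sum>i<m. ?f (m + i))" .
    also have "(\<Sum>i<m. ?f (m + i)) = (\<Sum>i<m. ?f i)"
      using st by (simp add: m_def nat_pow_mult[symmetric])
    finally have "even (\<Sum>i<2 * m. ?f i)" by (simp add: mult_2)
    then show ?thesis
      using odd_refl_alternating[of s t r' m] st 1 gens_square that by (simp add: rel_def)
  qed
  let ?r = "inv (word_prod G u) \<otimes> r \<otimes> word_prod G u"
  have r: "?r \<in> carrier G" using 1 assms(2) words_in_carrier by simp
  have sq: "\<And>x. x \<in> set w \<Longrightarrow> x \<otimes> x = \<one>" if "w \<in> lists S" for w using that gens_square by auto
  have "odd_refl (rel @ v) ?r = odd_refl v ?r"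
    using odd_refl_append[of rel ?r v] relodd[OF r] rel1 r relS words_in_carrier sq by simp
  then show ?thesis
    using odd_refl_append[of u r "rel @ v"] odd_refl_append[of u r v] 1 words_in_carrier sq assms(2)
    by (simp add: rel_def m_def)
qed

lemma relator_deletion_even_length:
  assumes "relator_deletion G S a b"
  shows "even (length a) = even (length b)"
  using assms by cases (auto simp: length_concat sum_list_replicate)

text \<open>Both invariants survive insertion and deletion of relators and vanish on the empty word,
  to which \<open>presentation\<close> connects \<open>ws\<close>.\<close>

lemma trivial_word:
  assumes "ws \<in> lists S" "word_prod G ws = \<one>"
  shows "even (length ws)" and "r \<in> carrier G \<Longrightarrow> \<not> odd_refl ws r"
proof -
  have "equivclp (relator_deletion G S) ws []" by (rule presentation[OF assms])
  then have "even (length ws) \<and> (\<forall>r\<in>carrier G. \<not> odd_refl ws r)"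
    by (induction rule: converse_equivclp_induct)
      (auto dest: relator_deletion_odd_refl relator_deletion_even_length)
  then show "even (length ws)" and "r \<in> carrier G \<Longrightarrow> \<not> odd_refl ws r" by auto
qed

text \<open>Appending \<open>rev v\<close> to \<open>u\<close> and to \<open>v\<close> gives two
  words for the identity. The suffix contributes the same parity to both, because the prefixes have
  equal product; hence both invariants depend only on the group element.\<close>

lemma equal_words:
  assumes "u \<in> lists S" "v \<in> lists S" "word_prod G u = word_prod G v"
  shows "even (length u) = even (length v)"
    and "r \<in> carrier G \<Longrightarrow> odd_refl u r = odd_refl v r"
proof -
  have rv: "rev v \<in> lists S" using assms by auto
  have 1: "word_prod G (u @ rev v) = \<one>" "word_prod G (v @ rev v) = \<one>"
    using assms rv word_inv words_in_carrier by (simp_all add: word_prod_append)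
  have in': "u @ rev v \<in> lists S" "v @ rev v \<in> lists S" using assms rv by auto
  show "even (length u) = even (length v)" using trivial_word(1)[OF in'(1) 1(1)] by simp
  assume r: "r \<in> carrier G"
  have sq: "\<And>x. x \<in> set w \<Longrightarrow> x \<otimes> x = \<one>" if "w \<in> lists S" for w using that gens_square by auto
  show "odd_refl u r = odd_refl v r"
    using trivial_word(2)[OF in'(1) 1(1) r] trivial_word(2)[OF in'(2) 1(2) r]
      odd_refl_append[of u r "rev v"] odd_refl_append[of v r "rev v"] assms r sq words_in_carrier
    by simp
qed

abbreviation len :: "'a \<Rightarrow> nat" where
  "len \<equiv> cox_length G S"

lemma carrier_eq_word_prods: "carrier G = word_prod G ` lists S"
  using generate_eq_word_prods[of S] gens_closed gens_square gens_generate by auto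

lemma reduced_word:
  assumes "w \<in> carrier G"
  obtains ws where "ws \<in> lists S" "length ws = len w" "word_prod G ws = w"
proof -
  obtain ws where "ws \<in> lists S" "word_prod G ws = w"
    using assms carrier_eq_word_prods by auto
  then have "\<exists>ws\<in>lists S. length ws = length ws \<and> word_prod G ws = w" by blast
  then have "\<exists>vs\<in>lists S. length vs = len w \<and> word_prod G vs = w"
    unfolding cox_length_def
    by (rule_tac LeastI[of "\<lambda>n. \<exists>ws\<in>lists S. length ws = n \<and> word_prod G ws = w" "length ws"])
      (use \<open>ws \<in> lists S\<close> \<open>word_prod G ws = w\<close> in blast)
  then show thesis using that by blast
qed

lemma len_word_le: "ws \<in> lists S \<Longrightarrow> len (word_prod G ws) \<le> length ws"
  unfolding cox_length_def by (rule Least_le) blast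

lemma len_eq_0:
  assumes "w \<in> carrier G"
  shows "len w = 0 \<longleftrightarrow> w = \<one>"
proof
  assume "len w = 0"
  moreover obtain ws where "length ws = len w" "word_prod G ws = w"
    using reduced_word assms by blast
  ultimately show "w = \<one>" by simp
next
  assume "w = \<one>"
  then show "len w = 0" using len_word_le[of "[]"] by simp
qed

lemma len_inv:
  assumes "w \<in> carrier G"
  shows "len (inv w) = len w"
proof -
  have le: "len (inv x) \<le> len x" if "x \<in> carrier G" for x
  proof -
    obtain ws where ws: "ws \<in> lists S" "length ws = len x" "word_prod G ws = x"
      using reduced_word \<open>x \<in> carrier G\<close> by blast
    then have "rev ws \<in> lists S" by auto
    then show ?thesis using len_word_le[of "rev ws"] ws word_inv by simp
  qed
  show ?thesis using le[OF assms] le[of "inv w"] assms by simp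
qed

lemma len_even:
  assumes "ws \<in> lists S"
  shows "even (len (word_prod G ws)) = even (length ws)"
proof -
  obtain us where "us \<in> lists S" "length us = len (word_prod G ws)"
      "word_prod G us = word_prod G ws"
    using reduced_word[of "word_prod G ws"] assms words_in_carrier by blast
  then show ?thesis using equal_words(1)[of us ws] assms by simp
qed

text \<open>A letter changes the length by at most one, and parity of length excludes no change at
  all.\<close>

lemma len_gen_mult:
  assumes "s \<in> S" "w \<in> carrier G"
  shows "len (s \<otimes> w) = Suc (len w) \<or> len w = Suc (len (s \<otimes> w))"
proof -
  have le: "len (s \<otimes> x) \<le> Suc (len x)" if "x \<in> carrier G" for x
  proof -
    obtain ws where ws: "ws \<in> lists S" "length ws = len x" "word_prod G ws = x"
      using reduced_word \<open>x \<in> carrier G\<close> by blast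
    then show ?thesis using len_word_le[of "s # ws"] assms by simp
  qed
  obtain ws where ws: "ws \<in> lists S" "word_prod G ws = w"
    using reduced_word assms by blast
  then have "even (len (s \<otimes> w)) \<noteq> even (len w)"
    using len_even[of "s # ws"] len_even[of ws] assms by auto
  then have ne: "len (s \<otimes> w) \<noteq> len w" by auto
  have "s \<otimes> (s \<otimes> w) = w" using assms by (rule gens_cancel)
  then have "len w \<le> Suc (len (s \<otimes> w))"
    using le[of "s \<otimes> w"] assms gens_in_carrier by simp
  then show ?thesis using ne le[OF assms(2)] by arith
qed

lemma len_mult_gen:
  assumes "s \<in> S" "w \<in> carrier G"
  shows "len (w \<otimes> s) = Suc (len w) \<or> len w = Suc (len (w \<otimes> s))"
proof -
  have "len (s \<otimes> inv w) = len (w \<otimes> s)"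
    using assms len_inv[of "w \<otimes> s"] gens_in_carrier gens_inv by (simp add: inv_mult_group)
  then show ?thesis using len_gen_mult[of s "inv w"] len_inv assms by simp
qed

text \<open>Let \<open>us\<close> be reduced for s w. If \<open>us\<close> met the reflection s an
  odd number of times, deleting a letter of \<open>us\<close> would spell w with fewer than l(s w)
  letters. So \<open>s # us\<close>, a word for w, meets s an odd number of times; by invariance so
  does \<open>ws\<close>, and \<open>odd_refl_split\<close> names the letter to delete.\<close>

lemma exchange:
  assumes ws: "ws \<in> lists S" and s: "s \<in> S"
    and less: "len (s \<otimes> word_prod G ws) < len (word_prod G ws)"
  shows "\<exists>u x v. ws = u @ x # v \<and> s \<otimes> word_prod G ws = word_prod G (u @ v)"
proof -
  let ?w = "word_prod G ws"
  have w: "?w \<in> carrier G" using ws words_in_carrier by blast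
  have sc: "s \<in> carrier G" using s gens_in_carrier by blast
  have sq: "\<And>x. x \<in> set w \<Longrightarrow> x \<otimes> x = \<one>" if "w \<in> lists S" for w using that gens_square by auto
  obtain us where us: "us \<in> lists S" "length us = len (s \<otimes> ?w)" "word_prod G us = s \<otimes> ?w"
    using reduced_word[of "s \<otimes> ?w"] w sc by auto
  have prod: "word_prod G (s # us) = ?w" using us s w gens_cancel by simp
  have "\<not> odd_refl us s"
  proof
    assume "odd_refl us s"
    then obtain u x v where e: "us = u @ x # v" "s \<otimes> word_prod G us = word_prod G (u @ v)"
      using odd_refl_split[of us s] us sc sq words_in_carrier by blast
    then have "len ?w \<le> length (u @ v)"
      using len_word_le[of "u @ v"] us prod by simp
    then show False using e us less by simp
  qed
  then have "odd_refl (s # us) s" using s sc gens_square by simp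
  then have "odd_refl ws s"
    using equal_words(2)[of "s # us" ws s] prod us ws s sc by simp
  then show ?thesis using odd_refl_split[of ws s] ws sc sq words_in_carrier by blast
qed

end

section \<open>Minimal length coset representatives\<close>

lemma (in group) conj_elt_closed [simp, intro]:
  "\<lbrakk>w \<in> carrier G; x \<in> carrier G\<rbrakk> \<Longrightarrow> conj_elt G w x \<in> carrier G"
  by (simp add: conj_elt_def)

lemma (in group) conj_elt_hom:
  assumes "w \<in> carrier G"
  shows "group_hom G G (conj_elt G w)"
proof -
  have "w \<otimes> (x \<otimes> y) \<otimes> inv w = w \<otimes> x \<otimes> inv w \<otimes> (w \<otimes> y \<otimes> inv w)"
    if "x \<in> carrier G" "y \<in> carrier G" for x y
  proof -
    have "inv w \<otimes> (w \<otimes> (y \<otimes> inv w)) = y \<otimes> inv w"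
      using assms that by (simp add: m_assoc[symmetric])
    then show ?thesis using assms that by (simp add: m_assoc)
  qed
  then show ?thesis
    using assms by unfold_locales (auto simp: hom_def conj_elt_def)
qed

lemma (in group) conj_elt_inv [simp]:
  assumes "w \<in> carrier G" "x \<in> carrier G"
  shows "conj_elt G (inv w) (conj_elt G w x) = x" "conj_elt G w (conj_elt G (inv w) x) = x"
proof -
  have "a \<otimes> (inv a \<otimes> y) = y" "inv a \<otimes> (a \<otimes> y) = y"
    if "a \<in> carrier G" "y \<in> carrier G" for a y
    using that by (simp_all add: m_assoc[symmetric])
  then show "conj_elt G (inv w) (conj_elt G w x) = x" "conj_elt G w (conj_elt G (inv w) x) = x"
    using assms by (simp_all add: conj_elt_def m_assoc)
qed

lemma (in group) conj_elt_mult: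
  "\<lbrakk>w \<in> carrier G; v \<in> carrier G; x \<in> carrier G\<rbrakk> \<Longrightarrow>
    conj_elt G (w \<otimes> v) x = conj_elt G w (conj_elt G v x)"
  by (simp add: conj_elt_def inv_mult_group m_assoc)

lemma (in group) conj_elt_generate:
  assumes "w \<in> carrier G" "K \<subseteq> carrier G"
  shows "conj_elt G w ` generate G K = generate G (conj_elt G w ` K)"
  using group_hom.generate_img[OF conj_elt_hom[OF assms(1)] assms(2)] by simp

section \<open>Parabolic subgroups, Deodhar's lemma and a comparison of ranks\<close>

context coxeter_group
begin

lemma parabolic_words: "J \<subseteq> S \<Longrightarrow> generate G J = word_prod G ` lists J"
  using gens_square gens_in_carrier by (intro generate_eq_word_prods) blast+

lemma parabolic_subgroup: "J \<subseteq> S \<Longrightarrow> subgroup (generate G J) G"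
  using gens_closed by (intro generate_is_subgroup) auto

lemma parabolic_closed: "\<lbrakk>J \<subseteq> S; x \<in> generate G J\<rbrakk> \<Longrightarrow> x \<in> carrier G"
  by (rule subgroup.mem_carrier[OF parabolic_subgroup])

lemma len_one [simp]: "len \<one> = 0"
  by (simp add: len_eq_0)

lemma mem_min_reps_left:
  assumes "J \<subseteq> S"
  shows "w \<in> min_reps_left G S J \<longleftrightarrow>
    w \<in> carrier G \<and> (\<forall>u\<in>generate G J. len w \<le> len (u \<otimes> w))"
proof -
  have "w \<in> generate G J #> w" if "w \<in> carrier G"
    using that generate.one[of G J] by (force simp: r_coset_def)
  then show ?thesis
    by (auto simp: min_reps_left_def minimal_elements_def r_coset_def)
qed

text \<open>Inversion preserves length and exchanges left and right cosets; the right-handed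
  statements below are deduced from the left-handed ones in this way.\<close>

lemma mem_min_reps_right:
  assumes J: "J \<subseteq> S"
  shows "w \<in> min_reps_right G S J \<longleftrightarrow> w \<in> carrier G \<and> inv w \<in> min_reps_left G S J"
proof -
  have "w \<in> w <# generate G J" if "w \<in> carrier G"
    using that generate.one[of G J] by (force simp: l_coset_def)
  then have 1: "w \<in> min_reps_right G S J \<longleftrightarrow>
    w \<in> carrier G \<and> (\<forall>u\<in>generate G J. len w \<le> len (w \<otimes> u))"
    by (auto simp: min_reps_right_def minimal_elements_def l_coset_def)
  have 2: "len (inv u \<otimes> inv w) = len (w \<otimes> u)" if "u \<in> generate G J" "w \<in> carrier G" for u
    using that len_inv[of "w \<otimes> u"] parabolic_closed[OF J] by (simp add: inv_mult_group)
  have 3: "inv u \<in> generate G J" if "u \<in> generate G J" for u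
    by (rule subgroup.m_inv_closed[OF parabolic_subgroup[OF J] that])
  show ?thesis
  proof (cases "w \<in> carrier G")
    case True
    have "(\<forall>u\<in>generate G J. len w \<le> len (w \<otimes> u)) \<longleftrightarrow>
      (\<forall>u\<in>generate G J. len w \<le> len (inv u \<otimes> inv w))" using 2 True by simp
    also have "\<dots> \<longleftrightarrow> (\<forall>u\<in>generate G J. len w \<le> len (u \<otimes> inv w))"
      using 3 by (metis inv_inv parabolic_closed[OF J])
    finally show ?thesis using 1 mem_min_reps_left[OF J] True by (simp add: len_inv)
  qed (use 1 in simp)
qed

text \<open>Minimality of \<open>us\<close> is required only among words in \<open>J\<close>, so
  that reducedness over \<open>S\<close> can be concluded afterwards by taking \<open>w\<close> to
  be 1. If a further letter shortened the product, exchange would delete a letter either from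
  \<open>us\<close>, against minimality, or from a reduced word of \<open>w\<close>, which would
  give a shorter element of W_J w.\<close>

lemma min_reps_left_word:
  assumes J: "J \<subseteq> S" and w: "w \<in> min_reps_left G S J" and us: "us \<in> lists J"
    and min: "\<And>vs. \<lbrakk>vs \<in> lists J; word_prod G vs = word_prod G us\<rbrakk> \<Longrightarrow> length us \<le> length vs"
  shows "len (word_prod G us \<otimes> w) = length us + len w"
  using us min
proof (induction us rule: list.induct)
  case Nil
  then show ?case using w mem_min_reps_left[OF J] by simp
next
  case (Cons s us)
  have s: "s \<in> S" "s \<in> J" and us: "us \<in> lists J" using Cons.prems J by auto
  have listsJ: "lists J \<subseteq> lists S" using J by auto
  have usS: "us \<in> lists S" using us listsJ by blast
  have sc: "s \<in> carrier G" using s gens_in_carrier by blast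
  have wc: "w \<in> carrier G" using w mem_min_reps_left[OF J] by simp
  let ?u = "word_prod G us"
  have uc: "?u \<in> carrier G" using usS words_in_carrier by blast
  have uJ: "?u \<in> generate G J" using us parabolic_words[OF J] by blast
  have "length us \<le> length vs" if "vs \<in> lists J" "word_prod G vs = ?u" for vs
    using Cons.prems(2)[of "s # vs"] that s by simp
  then have IH: "len (?u \<otimes> w) = length us + len w" using Cons.IH us by blast
  obtain ws where ws: "ws \<in> lists S" "length ws = len w" "word_prod G ws = w"
    using reduced_word wc by blast
  have prod: "word_prod G (us @ ws) = ?u \<otimes> w"
    using ws usS words_in_carrier by (simp add: word_prod_append)
  have "\<not> len (s \<otimes> (?u \<otimes> w)) < len (?u \<otimes> w)"
  proof
    assume "len (s \<otimes> (?u \<otimes> w)) < len (?u \<otimes> w)"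
    then obtain a x b where e: "us @ ws = a @ x # b" "s \<otimes> (?u \<otimes> w) = word_prod G (a @ b)"
      using exchange[of "us @ ws" s] prod ws usS s by auto
    have "a @ x # b \<in> lists S" using e(1) ws usS by (metis append_in_lists_conv)
    then have ab: "a \<in> lists S" "b \<in> lists S" by auto
    consider c where "us = a @ c" "c @ ws = x # b" "c \<noteq> []"
      | c where "us @ c = a" "ws = c @ x # b"
      using e(1) unfolding append_eq_append_conv2
      by (metis append_Nil append_Nil2)
    then show False
    proof cases
      case 1
      then obtain b' where b': "us = a @ x # b'" "b = b' @ ws" by (cases c) auto
      have in': "a @ b' \<in> lists J" using us b' by auto
      then have ab': "a @ b' \<in> lists S" using listsJ by blast
      have "word_prod G (a @ b) = word_prod G (a @ b') \<otimes> w"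
        using word_prod_append[of "a @ b'" ws] b' ws ab' words_in_carrier by simp
      then have "(s \<otimes> ?u) \<otimes> w = word_prod G (a @ b') \<otimes> w"
        using e sc uc wc by (simp add: m_assoc)
      then have "s \<otimes> ?u = word_prod G (a @ b')"
        using sc uc wc ab' words_in_carrier by (metis m_closed right_cancel word_prod_closed)
      then have "length (s # us) \<le> length (a @ b')" using Cons.prems(2)[of "a @ b'"] in' by simp
      then show False using b' by simp
    next
      case 2
      have cb: "c @ b \<in> lists S" using 2 ws by auto
      let ?p = "word_prod G (c @ b)"
      have pc: "?p \<in> carrier G" using cb words_in_carrier by blast
      have "a @ b = us @ (c @ b)" using 2 by simp
      then have "s \<otimes> (?u \<otimes> w) = ?u \<otimes> ?p"
        using e word_prod_append[of us "c @ b"] usS cb words_in_carrier by simp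
      \<comment> \<open>Moving s across the product of \<open>us\<close> shows that the shortened
        word of \<open>w\<close> still represents an element of W_J w.\<close>
      then have p: "?p = (inv ?u \<otimes> s \<otimes> ?u) \<otimes> w"
        using sc uc wc pc by (simp add: m_assoc inv_solve_left)
      have "inv ?u \<in> generate G J"
        by (rule subgroup.m_inv_closed[OF parabolic_subgroup[OF J] uJ])
      then have "inv ?u \<otimes> s \<otimes> ?u \<in> generate G J"
        using uJ s generate.incl[of s J] by (auto intro!: generate.eng)
      then have "len w \<le> len ?p" using w mem_min_reps_left[OF J] p by simp
      also have "\<dots> \<le> length (c @ b)" using cb by (rule len_word_le)
      finally show False using 2 ws by simp
    qed
  qed
  then have "len (s \<otimes> (?u \<otimes> w)) = Suc (len (?u \<otimes> w))"
    using len_gen_mult[of s "?u \<otimes> w"] s uc wc by auto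
  then show ?case using IH sc uc wc by (simp add: m_assoc)
qed

text \<open>The identity is a minimal representative, so additivity applied to it identifies
  shortest length over \<open>J\<close> with length over \<open>S\<close>.\<close>

lemma parabolic_reduced_word:
  assumes J: "J \<subseteq> S" and u: "u \<in> generate G J"
  shows "\<exists>us\<in>lists J. word_prod G us = u \<and> length us = len u \<and>
    (\<forall>w\<in>min_reps_left G S J. len (u \<otimes> w) = len u + len w)"
proof -
  have "\<exists>us. us \<in> lists J \<and> word_prod G us = u" using u parabolic_words[OF J] by auto
  then obtain us where us: "us \<in> lists J" "word_prod G us = u"
    and min: "\<And>vs. \<lbrakk>vs \<in> lists J; word_prod G vs = u\<rbrakk> \<Longrightarrow> length us \<le> length vs"
    using ex_has_least_nat[of "\<lambda>us. us \<in> lists J \<and> word_prod G us = u" _ length] by metis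
  have uc: "u \<in> carrier G" using parabolic_closed[OF J u] .
  have add: "len (u \<otimes> w) = length us + len w" if "w \<in> min_reps_left G S J" for w
    using min_reps_left_word[OF J that us(1)] min us(2) by simp
  have "\<one> \<in> min_reps_left G S J" by (simp add: mem_min_reps_left[OF J])
  then have "len u = length us" using add[of \<one>] uc by simp
  then show ?thesis using us add by auto
qed

lemma len_parabolic_mult:
  assumes "J \<subseteq> S" "w \<in> min_reps_left G S J" "u \<in> generate G J"
  shows "len (u \<otimes> w) = len u + len w"
  using assms parabolic_reduced_word by blast

lemma len_mult_parabolic:
  assumes J: "J \<subseteq> S" and w: "w \<in> min_reps_right G S J" and u: "u \<in> generate G J"
  shows "len (w \<otimes> u) = len w + len u"
proof -
  have uc: "u \<in> carrier G" and wc: "w \<in> carrier G"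
    using parabolic_closed[OF J u] w mem_min_reps_right[OF J] by auto
  have "inv u \<in> generate G J"
    by (rule subgroup.m_inv_closed[OF parabolic_subgroup[OF J] u])
  then have "len (inv u \<otimes> inv w) = len (inv u) + len (inv w)"
    using len_parabolic_mult[OF J] w mem_min_reps_right[OF J] by blast
  moreover have "len (inv u \<otimes> inv w) = len (w \<otimes> u)"
    using uc wc len_inv[of "w \<otimes> u"] by (simp add: inv_mult_group)
  ultimately show ?thesis using uc wc by (simp add: len_inv)
qed

lemma left_coset_decomposition:
  assumes J: "J \<subseteq> S" and w: "w \<in> carrier G"
  obtains u d where "u \<in> generate G J" "d \<in> min_reps_left G S J" "w = u \<otimes> d"
proof -
  obtain u where u: "u \<in> generate G J"
    and min: "\<And>v. v \<in> generate G J \<Longrightarrow> len (u \<otimes> w) \<le> len (v \<otimes> w)"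
    using ex_has_least_nat[of "\<lambda>u. u \<in> generate G J" _ "\<lambda>u. len (u \<otimes> w)"] generate.one by metis
  have uc: "u \<in> carrier G" using parabolic_closed[OF J u] .
  have "len (u \<otimes> w) \<le> len (v \<otimes> (u \<otimes> w))" if "v \<in> generate G J" for v
    using min[OF generate.eng[OF that u]] w uc parabolic_closed[OF J that] by (simp add: m_assoc)
  then have "u \<otimes> w \<in> min_reps_left G S J" using w uc by (simp add: mem_min_reps_left[OF J])
  moreover have "inv u \<in> generate G J"
    by (rule subgroup.m_inv_closed[OF parabolic_subgroup[OF J] u])
  moreover have "w = inv u \<otimes> (u \<otimes> w)" using w uc by (simp add: m_assoc[symmetric])
  ultimately show thesis using that by blast
qed

text \<open>Deodhar's lemma. Some t in \<open>J\<close> shortens b s. Exchange on a reduced word of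
  b followed by s deletes either the final s, so that t b s = b, or a letter of b, which would make
  t b shorter than b.\<close>

lemma min_reps_left_mult_gen:
  assumes J: "J \<subseteq> S" and b: "b \<in> min_reps_left G S J" and s: "s \<in> S"
    and not_min: "b \<otimes> s \<notin> min_reps_left G S J"
  obtains t where "t \<in> J" "b \<otimes> s = t \<otimes> b"
proof -
  have bc: "b \<in> carrier G" using b mem_min_reps_left[OF J] by simp
  have sc: "s \<in> carrier G" using s gens_in_carrier by blast
  obtain u d where ud: "u \<in> generate G J" "d \<in> min_reps_left G S J" "b \<otimes> s = u \<otimes> d"
    by (rule left_coset_decomposition[OF J m_closed[OF bc sc]])
  obtain us where us: "us \<in> lists J" "word_prod G us = u" "length us = len u"
    using parabolic_reduced_word[OF J ud(1)] by blast
  have dc: "d \<in> carrier G" using ud mem_min_reps_left[OF J] by simp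
  \<comment> \<open>The W_J-part u of b s is nontrivial; its first letter is the t sought, since
    multiplying by t strips it from u.\<close>
  have "us \<noteq> []" using us ud dc not_min by auto
  then obtain t vs where tv: "us = t # vs" by (cases us) auto
  have t: "t \<in> J" "t \<in> S" and vs: "vs \<in> lists J" using us tv J by auto
  have tc: "t \<in> carrier G" using t gens_in_carrier by blast
  let ?v = "word_prod G vs"
  have vsS: "vs \<in> lists S" using vs J by auto
  have v: "?v \<in> generate G J" "?v \<in> carrier G"
    using vs parabolic_words[OF J] vsS words_in_carrier by auto
  have tbs: "t \<otimes> (b \<otimes> s) = ?v \<otimes> d"
  proof -
    have "b \<otimes> s = t \<otimes> (?v \<otimes> d)" using ud(3) us(2) tv v dc tc by (simp flip: m_assoc)
    then show ?thesis using gens_cancel[of t "?v \<otimes> d"] t v dc by simp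
  qed
  have "len (?v \<otimes> d) = len ?v + len d" "len (b \<otimes> s) = len u + len d"
    using len_parabolic_mult[OF J] ud v by simp_all
  moreover have "len ?v < len u" using len_word_le[OF vsS] us tv by simp
  ultimately have less: "len (t \<otimes> (b \<otimes> s)) < len (b \<otimes> s)" using tbs by simp
  have min: "len b \<le> len (t \<otimes> b)" using b t mem_min_reps_left[OF J] generate.incl by metis
  have "len (t \<otimes> b) \<le> Suc (len (t \<otimes> (b \<otimes> s)))"
    using len_mult_gen[of s "t \<otimes> b"] s sc tc bc by (auto simp: m_assoc)
  then have lbs: "len (b \<otimes> s) = Suc (len b)" using min less len_mult_gen[of s b] s bc by auto
  obtain bs where bs: "bs \<in> lists S" "length bs = len b" "word_prod G bs = b"
    using reduced_word bc by blast
  have prod: "word_prod G (bs @ [s]) = b \<otimes> s"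
    using bs s sc words_in_carrier by (simp add: word_prod_append)
  obtain x y z where e: "bs @ [s] = x @ y # z" "t \<otimes> (b \<otimes> s) = word_prod G (x @ z)"
    using exchange[of "bs @ [s]" t] bs s t less prod by auto
  show thesis
  proof (cases z rule: rev_cases)
    case Nil
    then have "t \<otimes> (b \<otimes> s) = b" using e bs by simp
    then have "b \<otimes> s = t \<otimes> b" using gens_cancel[of t "b \<otimes> s"] t bc sc by simp
    then show thesis using t that by blast
  next
    case (snoc z' s')
    then have z: "bs = x @ y # z'" "s' = s" using e by auto
    have xz: "x @ z' \<in> lists S" using bs z by auto
    then have xzc: "word_prod G (x @ z') \<in> carrier G" using words_in_carrier by blast
    have "word_prod G (x @ z) = word_prod G (x @ z') \<otimes> s"
      using word_prod_append[of "x @ z'" "[s]"] xz snoc z sc words_in_carrier by simp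
    then have "t \<otimes> b = word_prod G (x @ z')"
      using e bc tc sc xzc by (metis m_assoc m_closed right_cancel)
    then have "len (t \<otimes> b) \<le> length (x @ z')" using len_word_le[OF xz] by simp
    then show thesis using min bs z by simp
  qed
qed

text \<open>The letters of \<open>x\<close> are passed across \<open>w\<close> one at a time: each
  is absorbed into the minimal representative or comes out on the left as some t in
  \<open>J\<close>. The condition on t confines q to a possibly smaller parabolic subgroup, which
  drives the descent in the main argument.\<close>

lemma min_reps_left_mult_parabolic:
  assumes J: "J \<subseteq> S" and w: "w \<in> min_reps_left G S J" and L: "L \<subseteq> S" and x: "x \<in> generate G L"
  obtains q b where "w \<otimes> x = q \<otimes> b" "b \<in> min_reps_left G S J"
    "q \<in> generate G {t \<in> J. conj_elt G (inv w) t \<in> generate G L}"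
proof -
  define M where "M = {t \<in> J. conj_elt G (inv w) t \<in> generate G L}"
  have wc: "w \<in> carrier G" using w mem_min_reps_left[OF J] by simp
  have MS: "M \<subseteq> S" using J by (auto simp: M_def)
  obtain xs where xs: "xs \<in> lists L" "x = word_prod G xs" using x parabolic_words[OF L] by auto
  \<comment> \<open>The witness \<open>l\<close> collects the absorbed letters. As b = w l, a letter
    with b s = t b satisfies w^-1 t w = l s l^-1, which lies in W_L.\<close>
  have "\<exists>q b l. w \<otimes> word_prod G xs = q \<otimes> b \<and> b \<in> min_reps_left G S J \<and>
    q \<in> generate G M \<and> l \<in> generate G L \<and> b = w \<otimes> l"
    using xs(1)
  proof (induction xs rule: rev_induct)
    case Nil
    show ?case using w wc by (intro exI[of _ \<one>] exI[of _ w]) (auto intro: generate.one)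
  next
    case (snoc s xs)
    have s: "s \<in> L" "s \<in> S" and xs: "xs \<in> lists L" "xs \<in> lists S" using snoc.prems L by auto
    have sc: "s \<in> carrier G" using s gens_in_carrier by blast
    obtain q b l where IH: "w \<otimes> word_prod G xs = q \<otimes> b" "b \<in> min_reps_left G S J"
      "q \<in> generate G M" "l \<in> generate G L" "b = w \<otimes> l"
      using snoc.IH xs by blast
    have qc: "q \<in> carrier G" and lc: "l \<in> carrier G" and bc: "b \<in> carrier G"
      using IH parabolic_closed[OF MS] parabolic_closed[OF L] mem_min_reps_left[OF J] by auto
    have sL: "s \<in> generate G L" using s by (intro generate.incl)
    have "w \<otimes> word_prod G (xs @ [s]) = (w \<otimes> word_prod G xs) \<otimes> s"
      using xs words_in_carrier sc wc by (simp add: word_prod_append m_assoc)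
    then have eq: "w \<otimes> word_prod G (xs @ [s]) = q \<otimes> (b \<otimes> s)"
      using IH(1) qc bc sc by (simp add: m_assoc)
    show ?case
    proof (cases "b \<otimes> s \<in> min_reps_left G S J")
      case True
      have "b \<otimes> s = w \<otimes> (l \<otimes> s)" using IH lc sc wc by (simp add: m_assoc)
      then show ?thesis using eq True IH generate.eng[OF IH(4) sL] by blast
    next
      case False
      then obtain t where t: "t \<in> J" "b \<otimes> s = t \<otimes> b"
        using min_reps_left_mult_gen[OF J IH(2) s(2)] by blast
      have tc: "t \<in> carrier G" using t J gens_in_carrier by blast
      have "w \<otimes> (l \<otimes> s) = t \<otimes> (w \<otimes> l)" using t(2) IH lc sc wc by (simp add: m_assoc)
      then have "conj_elt G (inv w) t = (inv w \<otimes> (w \<otimes> (l \<otimes> s))) \<otimes> inv l"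
        using lc sc wc tc by (simp add: conj_elt_def m_assoc)
      also have "\<dots> = (l \<otimes> s) \<otimes> inv l"
        using lc sc wc by (simp add: m_assoc[symmetric])
      also have "\<dots> \<in> generate G L"
        by (intro generate.eng IH(4) sL subgroup.m_inv_closed[OF parabolic_subgroup[OF L]])
      finally have "t \<in> M" using t by (simp add: M_def)
      then have "q \<otimes> t \<in> generate G M" using IH(3) by (blast intro: generate.eng generate.incl)
      moreover have "w \<otimes> word_prod G (xs @ [s]) = (q \<otimes> t) \<otimes> b"
        using eq t tc qc bc by (simp add: m_assoc)
      ultimately show ?thesis using IH by blast
    qed
  qed
  then show thesis using that xs(2) unfolding M_def by blast
qed

lemma min_reps_right_mult_parabolic:
  assumes J: "J \<subseteq> S" and w: "w \<in> min_reps_right G S J" and L: "L \<subseteq> S" and x: "x \<in> generate G L"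
  obtains q b where "x \<otimes> w = b \<otimes> q" "b \<in> min_reps_right G S J"
    "q \<in> generate G {t \<in> J. conj_elt G w t \<in> generate G L}"
proof -
  let ?M = "{t \<in> J. conj_elt G w t \<in> generate G L}"
  have wc: "w \<in> carrier G" and w': "inv w \<in> min_reps_left G S J"
    using w mem_min_reps_right[OF J] by auto
  have xc: "x \<in> carrier G" using parabolic_closed[OF L x] .
  have ix: "inv x \<in> generate G L" by (rule subgroup.m_inv_closed[OF parabolic_subgroup[OF L] x])
  obtain q b where qb: "inv w \<otimes> inv x = q \<otimes> b" "b \<in> min_reps_left G S J"
    "q \<in> generate G ?M"
    by (rule min_reps_left_mult_parabolic[OF J w' L ix]) (use wc in simp)
  have MS: "?M \<subseteq> S" using J by auto
  have bc: "b \<in> carrier G" and qc: "q \<in> carrier G"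
    using qb mem_min_reps_left[OF J] parabolic_closed[OF MS] by auto
  have "x \<otimes> w = inv (inv w \<otimes> inv x)" using xc wc by (simp add: inv_mult_group)
  also have "\<dots> = inv b \<otimes> inv q" using qb bc qc by (simp add: inv_mult_group)
  finally have "x \<otimes> w = inv b \<otimes> inv q" .
  moreover have "inv b \<in> min_reps_right G S J" using qb bc mem_min_reps_right[OF J] by simp
  moreover have "inv q \<in> generate G ?M"
    by (rule subgroup.m_inv_closed[OF parabolic_subgroup[OF MS] qb(3)])
  ultimately show thesis using that by blast
qed

text \<open>Writing w^-1 = u f with u in W_L and f minimal in W_L f, conjugation by f embeds
  \<open>M\<close> into \<open>L\<close>. If the cardinalities agree, this embedding is onto, and
  minimality of \<open>w\<close> forces u = 1, so that w^-1 itself induces the bijection.\<close>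

lemma min_reps_left_rank:
  assumes J: "J \<subseteq> S" and w: "w \<in> min_reps_left G S J" and L: "L \<subseteq> S"
    and M: "M \<subseteq> J" and wM: "conj_elt G (inv w) ` M \<subseteq> generate G L"
  shows "card M \<le> card L" and "card M = card L \<Longrightarrow> conj_elt G (inv w) ` M = L"
proof -
  have wc: "w \<in> carrier G" using w mem_min_reps_left[OF J] by simp
  have MS: "M \<subseteq> S" using M J by blast
  have finL: "finite L" using L finite_gens finite_subset by blast
  obtain u f where uf: "u \<in> generate G L" "f \<in> min_reps_left G S L" "inv w = u \<otimes> f"
    using left_coset_decomposition[OF L] wc by (metis inv_closed)
  have uc: "u \<in> carrier G" and fc: "f \<in> carrier G"
    using uf parabolic_closed[OF L] mem_min_reps_left[OF L] by auto
  have iu: "inv u \<in> generate G L" by (rule subgroup.m_inv_closed[OF parabolic_subgroup[OF L] uf(1)])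
  have img: "conj_elt G f t \<in> L" if t: "t \<in> M" for t
  proof -
    have tS: "t \<in> S" and tc: "t \<in> carrier G" using t MS gens_in_carrier by auto
    let ?y = "conj_elt G f t"
    have "conj_elt G (inv w) t = conj_elt G u ?y"
      using uf(3) uc fc tc by (simp add: conj_elt_mult)
    then have "?y = inv u \<otimes> conj_elt G (inv w) t \<otimes> u"
      using uc fc tc conj_elt_inv(1)[of u ?y] by (simp add: conj_elt_def[of _ "inv u"])
    moreover have "inv u \<otimes> conj_elt G (inv w) t \<otimes> u \<in> generate G L"
      using iu uf(1) wM t by (intro generate.eng) auto
    ultimately have y: "?y \<in> generate G L" by simp
    \<comment> \<open>With y = f t f^-1 in W_L, additivity gives l(y) + l(f) = l(f t) \<le> l(f) +
      1. So y, being nontrivial, has length one and is a letter of \<open>L\<close>.\<close>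
    have "?y \<otimes> f = f \<otimes> t" using fc tc by (simp add: conj_elt_def m_assoc)
    then have "len ?y + len f \<le> Suc (len f)"
      using len_parabolic_mult[OF L uf(2) y] len_mult_gen[of t f] tS fc by auto
    moreover have "?y \<noteq> \<one>"
    proof
      assume "?y = \<one>"
      then have "conj_elt G (inv f) \<one> = t" using fc tc by (metis conj_elt_inv(1))
      then show False using fc gens_not_one[OF tS] by (simp add: conj_elt_def)
    qed
    ultimately have 1: "len ?y = 1" using len_eq_0[of ?y] fc tc by auto
    obtain ys where "ys \<in> lists L" "word_prod G ys = ?y" "length ys = len ?y"
      using parabolic_reduced_word[OF L y] by blast
    then obtain y' where "ys = [y']" "y' \<in> L" "word_prod G [y'] = ?y"
      using 1 by (auto simp: length_Suc_conv)
    then show "?y \<in> L" using L gens_in_carrier by auto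
  qed
  have inj: "inj_on (conj_elt G f) M"
    using fc MS gens_in_carrier by (intro inj_on_inverseI[of _ "conj_elt G (inv f)"]) auto
  show "card M \<le> card L" using img finL inj by (intro card_inj_on_le[of "conj_elt G f"]) auto
  assume "card M = card L"
  then have fM: "conj_elt G f ` M = L"
    using img finL inj by (intro card_subset_eq) (auto simp: card_image)
  \<comment> \<open>As conjugation by f carries W_M onto W_L, u = f m f^-1 with m in W_M and w^-1 =
    f m. Then f^-1 = m w lies in W_J w, whence l(w) \<le> l(f), while l(w) = l(u) + l(f).\<close>
  have "u \<in> conj_elt G f ` generate G M"
    using uf(1) fM conj_elt_generate[of f M] fc MS gens_closed by auto
  then obtain m where m: "m \<in> generate G M" "u = conj_elt G f m" by blast
  have mc: "m \<in> carrier G" using m parabolic_closed[OF MS] by blast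
  have "inv w = f \<otimes> m" using uf(3) m fc mc by (simp add: conj_elt_def m_assoc)
  then have "w = inv (f \<otimes> m)" using wc by (metis inv_inv)
  then have "inv f = m \<otimes> w" using fc mc by (simp add: inv_mult_group m_assoc[symmetric])
  moreover have "m \<in> generate G J" using m mono_generate[OF M] by blast
  ultimately have "len w \<le> len (inv f)" using w mem_min_reps_left[OF J] by simp
  moreover have "len w = len u + len f"
    using len_parabolic_mult[OF L uf(2,1)] uf(3) len_inv[OF wc] by simp
  ultimately have "u = \<one>" using len_inv fc len_eq_0[OF uc] by simp
  then show "conj_elt G (inv w) ` M = L" using fM uf(3) fc by simp
qed

lemma len_gen: "s \<in> S \<Longrightarrow> len s = 1"
  using len_mult_gen[of s \<one>] gens_in_carrier by simp

text \<open>A reduced word in \<open>K\<close> is carried letter by letter to a word of simple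
  reflections, so length does not grow; the inverse conjugation gives the other inequality.\<close>

lemma len_conj_elt:
  assumes w: "w \<in> carrier G" and K: "K \<subseteq> S" and wK: "conj_elt G w ` K \<subseteq> S"
    and v: "v \<in> generate G K"
  shows "len (conj_elt G w v) = len v"
proof -
  have le: "len (conj_elt G a x) \<le> len x"
    if a: "a \<in> carrier G" and M: "M \<subseteq> S" "conj_elt G a ` M \<subseteq> S" and x: "x \<in> generate G M" for a M x
  proof -
    obtain us where us: "us \<in> lists M" "word_prod G us = x" "length us = len x"
      using parabolic_reduced_word[OF M(1) x] by blast
    have "us \<in> lists M \<Longrightarrow>
      conj_elt G a (word_prod G us) = word_prod G (map (conj_elt G a) us) \<and>
      map (conj_elt G a) us \<in> lists S"
    proof (induction us rule: list.induct)
      case Nil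
      then show ?case using a by (simp add: conj_elt_def)
    next
      case (Cons s us)
      have s: "s \<in> M" "s \<in> carrier G" and us: "us \<in> lists M"
        using Cons.prems M gens_closed by auto
      have "us \<in> lists S" using us M by auto
      then have "word_prod G us \<in> carrier G" using words_in_carrier by blast
      then show ?case
        using Cons.IH us s M(2) group_hom.hom_mult[OF conj_elt_hom[OF a]] by auto
    qed
    then show ?thesis using us len_word_le by (metis length_map)
  qed
  have vc: "v \<in> carrier G" using parabolic_closed[OF K v] .
  have KG: "K \<subseteq> carrier G" using K gens_closed by blast
  have "conj_elt G (inv w) ` conj_elt G w ` K = K"
    using w KG by (force simp: image_image)
  moreover have "conj_elt G w v \<in> generate G (conj_elt G w ` K)"
    using v conj_elt_generate[OF w KG] by blast
  ultimately have "len (conj_elt G (inv w) (conj_elt G w v)) \<le> len (conj_elt G w v)"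
    using le[of "inv w" "conj_elt G w ` K"] w wK K by simp
  then show ?thesis using le[OF w K wK v] w vc by simp
qed

end


section \<open>Admissible triples\<close>

locale coxeter_pair =
  A: coxeter_group W1 I1 + B: coxeter_group W2 I2
  for W1 :: "('a, 'm) monoid_scheme" and I1 and W2 :: "('b, 'n) monoid_scheme" and I2
begin

abbreviation mult1 (infixl \<open>\<cdot>\<close> 70) where "x \<cdot> y \<equiv> x \<otimes>\<^bsub>W1\<^esub> y"
abbreviation mult2 (infixl \<open>\<star>\<close> 70) where "x \<star> y \<equiv> x \<otimes>\<^bsub>W2\<^esub> y"

end

locale admissible = coxeter_pair W1 I1 W2 I2
  for W1 :: "('a, 'm) monoid_scheme" and I1 and W2 :: "('b, 'n) monoid_scheme" and I2 +
  fixes c :: "('a, 'b) triple"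
  assumes admissible: "admissible_triple W1 I1 W2 I2 c"
begin

lemma src_subset: "src c \<subseteq> I1" and tgt_subset: "tgt c \<subseteq> I2" and dia_src: "dia c ` src c = tgt c"
  using admissible by (simp_all add: admissible_triple_def)

lemma dia_gens: "s \<in> src c \<Longrightarrow> dia c s \<in> I2"
  using dia_src tgt_subset by blast

lemma src_closed: "x \<in> generate W1 (src c) \<Longrightarrow> x \<in> carrier W1"
  by (rule A.parabolic_closed[OF src_subset])

lemma dia_group_hom:
  "group_hom (W1\<lparr>carrier := generate W1 (src c)\<rparr>) (W2\<lparr>carrier := generate W2 (tgt c)\<rparr>) (dia c)"
  using admissible A.subgroup_imp_group[OF A.parabolic_subgroup[OF src_subset]]
    B.subgroup_imp_group[OF B.parabolic_subgroup[OF tgt_subset]]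
  by (simp add: group_hom_def group_hom_axioms_def admissible_triple_def iso_def)

lemma dia_inj: "inj_on (dia c) (generate W1 (src c))"
  using admissible by (simp add: admissible_triple_def iso_def bij_betw_def)

lemma dia_tgt: "x \<in> generate W1 (src c) \<Longrightarrow> dia c x \<in> generate W2 (tgt c)"
  using group_hom.hom_closed[OF dia_group_hom] by simp

lemma dia_closed: "x \<in> generate W1 (src c) \<Longrightarrow> dia c x \<in> carrier W2"
  by (rule B.parabolic_closed[OF tgt_subset dia_tgt])

lemma dia_one [simp]: "dia c \<one>\<^bsub>W1\<^esub> = \<one>\<^bsub>W2\<^esub>"
  using group_hom.hom_one[OF dia_group_hom] by simp

lemma dia_mult:
  "\<lbrakk>x \<in> generate W1 (src c); y \<in> generate W1 (src c)\<rbrakk> \<Longrightarrow> dia c (x \<cdot> y) = dia c x \<star> dia c y"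
  using group_hom.hom_mult[OF dia_group_hom] by simp

lemma src_inv: "x \<in> generate W1 (src c) \<Longrightarrow> inv\<^bsub>W1\<^esub> x \<in> generate W1 (src c)"
  by (rule subgroup.m_inv_closed[OF A.parabolic_subgroup[OF src_subset]])

lemma dia_inv:
  assumes "x \<in> generate W1 (src c)"
  shows "dia c (inv\<^bsub>W1\<^esub> x) = inv\<^bsub>W2\<^esub> (dia c x)"
proof (rule B.inv_equality[symmetric])
  show "dia c (inv\<^bsub>W1\<^esub> x) \<star> dia c x = \<one>\<^bsub>W2\<^esub>"
    using dia_mult[OF src_inv[OF assms] assms] src_closed[OF assms] by simp
qed (use assms dia_closed src_inv in auto)

lemma dia_generate:
  assumes "K \<subseteq> src c"
  shows "dia c ` generate W1 K = generate W2 (dia c ` K)"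
proof -
  have K: "K \<subseteq> generate W1 (src c)" using assms by (blast intro: generate.incl)
  then have dK: "dia c ` K \<subseteq> generate W2 (tgt c)" using dia_tgt by blast
  show ?thesis
    using group_hom.generate_img[OF dia_group_hom, of K] K
      A.generate_consistent[OF K A.parabolic_subgroup[OF src_subset]]
      B.generate_consistent[OF dK B.parabolic_subgroup[OF tgt_subset]]
    by simp
qed

lemma dia_word:
  assumes "ss \<in> lists (src c)"
  shows "word_prod W1 ss \<in> generate W1 (src c)"
    and "dia c (word_prod W1 ss) = word_prod W2 (map (dia c) ss)"
proof -
  have in': "ss \<in> lists (src c) \<Longrightarrow> word_prod W1 ss \<in> generate W1 (src c)" for ss
    using A.parabolic_words[OF src_subset] by blast
  show "word_prod W1 ss \<in> generate W1 (src c)" using in' assms .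
  show "dia c (word_prod W1 ss) = word_prod W2 (map (dia c) ss)"
    using assms by (induction ss) (simp_all add: dia_mult generate.incl in')
qed

end

section \<open>Removing a parabolic factor by elementary reductions\<close>

locale admissible_pair =
  admissible W1 I1 W2 I2 c + T': admissible W1 I1 W2 I2 c'
  for W1 :: "('a, 'm) monoid_scheme" and I1 and W2 :: "('b, 'n) monoid_scheme" and I2 and c c'
begin

abbreviation plen where "plen \<equiv> prod_length W1 I1 W2 I2"
abbreviation red where "red \<equiv> reduces_to W1 I1 W2 I2 c c'"

text \<open>Letters are peeled off p from the right: each step shortens the second component by one
  and lengthens the first by at most one. The word must be reduced for \<open>dia c p\<close> in
  \<open>W2\<close>, since the minimal representative \<open>b\<close> sits in the second
  component.\<close>

lemma reduces_right:
  assumes "a \<in> carrier W1" and b: "b \<in> min_reps_right W2 I2 (tgt c)"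
    and p: "p \<in> generate W1 (src c)"
  shows "red (a, b \<star> dia c p) (a \<cdot> inv\<^bsub>W1\<^esub> p, b)"
proof -
  have bc: "b \<in> carrier W2" using b B.mem_min_reps_right[OF tgt_subset] by blast
  obtain ts where ts: "ts \<in> lists (tgt c)" "word_prod W2 ts = dia c p" "length ts = B.len (dia c p)"
    using B.parabolic_reduced_word[OF tgt_subset dia_tgt[OF p]] by blast
  \<comment> \<open>A reduced word in \<open>tgt c\<close> lifts letter by letter to
    \<open>src c\<close>; injectivity of \<open>dia c\<close> then shows that the lifted word spells
    p.\<close>
  have "ts \<in> map (dia c) ` lists (src c)" using ts(1) dia_src by (metis lists_image)
  then obtain ss where ss: "ss \<in> lists (src c)" "ts = map (dia c) ss" by blast
  have "dia c (word_prod W1 ss) = dia c p" using ss ts dia_word(2) by simp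
  then have prod: "word_prod W1 ss = p" using inj_onD[OF dia_inj] p dia_word(1)[OF ss(1)] by blast
  have "red (a, b \<star> dia c (word_prod W1 ss)) (a \<cdot> inv\<^bsub>W1\<^esub> (word_prod W1 ss), b)"
    if "a \<in> carrier W1" "ss \<in> lists (src c)" "length ss = B.len (dia c (word_prod W1 ss))" for a ss
    using that
  proof (induction ss arbitrary: a rule: rev_induct)
    case Nil
    then show ?case using bc by (simp add: reduces_to_def)
  next
    case (snoc s ss)
    have s: "s \<in> src c" and ss: "ss \<in> lists (src c)" using snoc.prems by auto
    have sI: "s \<in> I1" and sc: "s \<in> carrier W1" using s src_subset A.gens_in_carrier by auto
    have sg: "s \<in> generate W1 (src c)" using s by (rule generate.incl)
    define p where "p = word_prod W1 ss"
    have pg: "p \<in> generate W1 (src c)" using dia_word(1)[OF ss] by (simp add: p_def)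
    have pc: "p \<in> carrier W1" using src_closed[OF pg] .
    have ps: "word_prod W1 (ss @ [s]) = p \<cdot> s"
      using A.word_prod_append[of ss "[s]"] ss sc src_subset A.gens_closed by (auto simp: p_def)
    have dps: "dia c (p \<cdot> s) = dia c p \<star> dia c s" using dia_mult pg sg .
    have ds: "dia c s \<in> I2" using s dia_src tgt_subset by blast
    have dc: "dia c p \<in> carrier W2" "dia c s \<in> carrier W2" using dia_closed pg sg by auto
    have "map (dia c) ss \<in> lists I2" using ss dia_gens by auto
    \<comment> \<open>A prefix of a reduced word is reduced; this keeps the induction hypothesis
      applicable.\<close>
    then have "B.len (dia c p) \<le> length ss"
      using B.len_word_le[of "map (dia c) ss"] dia_word(2)[OF ss] by (simp add: p_def)
    then have lp: "B.len (dia c p) = length ss"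
      using snoc.prems(3) B.len_mult_gen[OF ds dc(1)] ps dps by simp
    have "red (a \<cdot> s, b \<star> dia c p) ((a \<cdot> s) \<cdot> inv\<^bsub>W1\<^esub> p, b)"
      using snoc.IH[of "a \<cdot> s"] ss snoc.prems(1) sc lp by (simp add: p_def)
    moreover have "(a \<cdot> s) \<cdot> inv\<^bsub>W1\<^esub> p = a \<cdot> inv\<^bsub>W1\<^esub> (p \<cdot> s)"
      using snoc.prems(1) sc pc A.gens_inv[OF sI] by (simp add: A.inv_mult_group A.m_assoc)
    moreover have "elementary_reduction W1 I1 W2 I2 c c' (a, b \<star> dia c (p \<cdot> s)) (a \<cdot> s, b \<star> dia c p)"
    proof (rule elementary_reduction.right[OF _ s])
      show "(a \<cdot> s, b \<star> dia c p) \<in> carrier (W1 \<times>\<times> W2)" using snoc.prems(1) sc bc dc by simp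
      show "(a, b \<star> dia c (p \<cdot> s)) = (a \<cdot> s, b \<star> dia c p) \<otimes>\<^bsub>W1 \<times>\<times> W2\<^esub> (s, dia c s)"
        using snoc.prems(1) sc bc dc A.gens_square[OF sI] dps by (simp add: A.m_assoc B.m_assoc)
      have "B.len (b \<star> dia c (p \<cdot> s)) = B.len b + B.len (dia c (p \<cdot> s))"
        using B.len_mult_parabolic[OF tgt_subset b dia_tgt] pg sg generate.eng by metis
      moreover have "B.len (b \<star> dia c p) = B.len b + B.len (dia c p)"
        using B.len_mult_parabolic[OF tgt_subset b dia_tgt[OF pg]] .
      ultimately show "plen (a \<cdot> s, b \<star> dia c p) \<le> plen (a, b \<star> dia c (p \<cdot> s))"
        using snoc.prems(3) lp A.len_mult_gen[OF sI snoc.prems(1)] ps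
        by (auto simp: prod_length_def)
    qed
    ultimately show ?case unfolding ps reduces_to_def by simp
  qed
  from this[OF assms(1) ss(1)] show ?thesis using prod ss ts by simp
qed

text \<open>Mirror image of \<open>reduces_right\<close>: the minimal representative is now in the
  first component, so the word of p is chosen reduced in \<open>W1\<close> and is consumed from the
  left.\<close>

lemma reduces_left:
  assumes "b \<in> carrier W2" and a: "a \<in> min_reps_left W1 I1 (src c')"
    and p: "p \<in> generate W1 (src c')"
  shows "red (p \<cdot> a, b) (a, inv\<^bsub>W2\<^esub> (dia c' p) \<star> b)"
proof -
  have ac: "a \<in> carrier W1" using a A.mem_min_reps_left[OF T'.src_subset] by blast
  obtain ss where ss: "ss \<in> lists (src c')" "word_prod W1 ss = p" "length ss = A.len p"
    using A.parabolic_reduced_word[OF T'.src_subset p] by blast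
  have "red (word_prod W1 ss \<cdot> a, b) (a, inv\<^bsub>W2\<^esub> (dia c' (word_prod W1 ss)) \<star> b)"
    if "b \<in> carrier W2" "ss \<in> lists (src c')" "length ss = A.len (word_prod W1 ss)" for b ss
    using that(2,1,3)
  proof (induction ss arbitrary: b rule: list.induct)
    case Nil
    then show ?case using ac by (simp add: reduces_to_def)
  next
    case (Cons s ss)
    have s: "s \<in> src c'" and ss: "ss \<in> lists (src c')" using Cons.prems by auto
    have sI: "s \<in> I1" and sc: "s \<in> carrier W1" using s T'.src_subset A.gens_in_carrier by auto
    have sg: "s \<in> generate W1 (src c')" using s by (rule generate.incl)
    define p where "p = word_prod W1 ss"
    have pg: "p \<in> generate W1 (src c')" using T'.dia_word(1)[OF ss] by (simp add: p_def)
    have pc: "p \<in> carrier W1" using T'.src_closed[OF pg] .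
    have sp: "word_prod W1 (s # ss) = s \<cdot> p" by (simp add: p_def)
    have spg: "s \<cdot> p \<in> generate W1 (src c')" using sg pg by (rule generate.eng)
    have dsp: "dia c' (s \<cdot> p) = dia c' s \<star> dia c' p" using T'.dia_mult sg pg .
    have ds: "dia c' s \<in> I2" using s T'.dia_src T'.tgt_subset by blast
    have dc: "dia c' p \<in> carrier W2" "dia c' s \<in> carrier W2" using T'.dia_closed pg sg by auto
    have "ss \<in> lists I1" using ss T'.src_subset by auto
    then have "A.len p \<le> length ss" using A.len_word_le by (simp add: p_def)
    then have lp: "A.len p = length ss"
      using Cons.prems(3) A.len_gen_mult[OF sI pc] sp by simp
    have "red (p \<cdot> a, dia c' s \<star> b) (a, inv\<^bsub>W2\<^esub> (dia c' p) \<star> (dia c' s \<star> b))"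
      using Cons.IH[OF ss, of "dia c' s \<star> b"] Cons.prems(2) dc lp by (simp add: p_def)
    moreover have "inv\<^bsub>W2\<^esub> (dia c' p) \<star> (dia c' s \<star> b) = inv\<^bsub>W2\<^esub> (dia c' (s \<cdot> p)) \<star> b"
      using Cons.prems(2) dc B.gens_inv[OF ds] dsp by (simp add: B.inv_mult_group B.m_assoc)
    moreover have "elementary_reduction W1 I1 W2 I2 c c' (s \<cdot> p \<cdot> a, b) (p \<cdot> a, dia c' s \<star> b)"
    proof (rule elementary_reduction.left[OF _ s])
      show "(p \<cdot> a, dia c' s \<star> b) \<in> carrier (W1 \<times>\<times> W2)" using Cons.prems(2) pc ac dc by simp
      show "(s \<cdot> p \<cdot> a, b) = (s, dia c' s) \<otimes>\<^bsub>W1 \<times>\<times> W2\<^esub> (p \<cdot> a, dia c' s \<star> b)"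
        using Cons.prems(2) sc pc ac dc B.gens_cancel[OF ds] by (simp add: A.m_assoc)
      have "A.len (s \<cdot> p \<cdot> a) = A.len (s \<cdot> p) + A.len a" "A.len (p \<cdot> a) = A.len p + A.len a"
        using A.len_parabolic_mult[OF T'.src_subset a] spg pg by auto
      then show "plen (p \<cdot> a, dia c' s \<star> b) \<le> plen (s \<cdot> p \<cdot> a, b)"
        using Cons.prems(3) lp B.len_gen_mult[OF ds Cons.prems(2)] sp
        by (auto simp: prod_length_def)
    qed
    ultimately show ?case unfolding sp reduces_to_def by simp
  qed
  from this[OF assms(1) ss(1)] show ?thesis using ss by simp
qed

end

section \<open>The decreasing sequence of parabolic subgroups attached to \<open>w1\<close> and
  \<open>w2\<close>\<close>

locale piece_pair = admissible_pair W1 I1 W2 I2 c c'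
  for W1 :: "('a, 'm) monoid_scheme" and I1 and W2 :: "('b, 'n) monoid_scheme" and I2 and c c' +
  fixes w1 w2
  assumes w1: "w1 \<in> min_reps_left W1 I1 (src c')"
    and w2: "w2 \<in> min_reps_right W2 I2 (tgt c)"
begin

abbreviation K where "K \<equiv> stable_subset W1 W2 w1 w2 c c'"

text \<open>The condition whose largest solution is \<open>K\<close>, kept as a predicate so that it
  can be verified for the fixed point of the descent.\<close>

definition stable :: "'a set \<Rightarrow> bool" where
  "stable L \<longleftrightarrow> L \<subseteq> src c \<and> conj_elt W1 w1 ` L \<subseteq> src c' \<and>
    dia c' ` conj_elt W1 w1 ` L = conj_elt W2 w2 ` dia c ` L"

text \<open>The letters t for which \<delta>(t) may emerge on the right when \<delta>'(x), with x in
  W_L, is moved across \<open>w2\<close> by Deodhar's lemma.\<close>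

definition pull_right :: "'a set \<Rightarrow> 'a set" where
  "pull_right L = {t \<in> src c. conj_elt W2 w2 (dia c t) \<in> dia c' ` generate W1 L}"

text \<open>Likewise the letters that may emerge on the left when an element of W_L is moved across
  \<open>w1\<close>.\<close>

definition pull_left :: "'a set \<Rightarrow> 'a set" where
  "pull_left L = {s \<in> src c'. conj_elt W1 (inv\<^bsub>W1\<^esub> w1) s \<in> generate W1 L}"

lemma w1_closed [simp, intro]: "w1 \<in> carrier W1"
  using w1 A.mem_min_reps_left[OF T'.src_subset] by blast

lemma w2_closed [simp, intro]: "w2 \<in> carrier W2"
  using w2 B.mem_min_reps_right[OF tgt_subset] by blast

text \<open>Images commute with unions, so the union of all stable sets is stable; this makes
  \<open>GREATEST\<close> well defined.\<close>

lemma stable_K: "stable K" and stable_subset_K: "stable L \<Longrightarrow> L \<subseteq> K"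
proof -
  let ?U = "\<Union>{L. stable L}"
  let ?f = "\<lambda>x. dia c' (conj_elt W1 w1 x)" and ?g = "\<lambda>x. conj_elt W2 w2 (dia c x)"
  have "?f ` L = ?g ` L" if "stable L" for L
    using that by (simp add: stable_def image_image)
  then have "(\<Union>L\<in>{L. stable L}. ?f ` L) = (\<Union>L\<in>{L. stable L}. ?g ` L)" by simp
  moreover have "?f ` ?U = (\<Union>L\<in>{L. stable L}. ?f ` L)" "?g ` ?U = (\<Union>L\<in>{L. stable L}. ?g ` L)"
    by (rule image_Union)+
  ultimately have "?f ` ?U = ?g ` ?U" by simp
  moreover have "?U \<subseteq> src c" "conj_elt W1 w1 ` ?U \<subseteq> src c'" by (auto simp: stable_def)
  ultimately have U: "stable ?U" by (simp add: stable_def image_image)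
  have "K = (GREATEST L. stable L)" by (simp add: stable_subset_def stable_def)
  also have "\<dots> = ?U" using U by (rule Greatest_equality) auto
  finally have "K = ?U" .
  then show "stable K" and "stable L \<Longrightarrow> L \<subseteq> K" using U by auto
qed

lemma K_src: "K \<subseteq> src c"
  using stable_K by (simp add: stable_def)

lemma pull_right_src: "pull_right L \<subseteq> src c" and pull_left_src: "pull_left L \<subseteq> src c'"
  by (auto simp: pull_right_def pull_left_def)

lemma pull_mono:
  assumes "L \<subseteq> L'"
  shows "pull_left (pull_right L) \<subseteq> pull_left (pull_right L')"
proof -
  have "pull_right L \<subseteq> pull_right L'"
    using A.mono_generate[OF assms] by (auto simp: pull_right_def)
  from A.mono_generate[OF this] show ?thesis by (auto simp: pull_left_def)
qed

text \<open>Together with \<open>K_pull_left\<close> this keeps the conjugate of \<open>K\<close> by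
  \<open>w1\<close> inside every term of the sequence, so that v can always be moved along with the
  other factors.\<close>

lemma K_pull_right:
  assumes "conj_elt W1 w1 ` K \<subseteq> L"
  shows "K \<subseteq> pull_right L"
proof
  fix t assume t: "t \<in> K"
  then have "conj_elt W2 w2 (dia c t) \<in> dia c' ` conj_elt W1 w1 ` K"
    using stable_K by (simp add: stable_def)
  moreover have "L \<subseteq> generate W1 L" by (auto intro: generate.incl)
  then have "dia c' ` conj_elt W1 w1 ` K \<subseteq> dia c' ` generate W1 L"
    using assms by (intro image_mono) simp
  ultimately have "conj_elt W2 w2 (dia c t) \<in> dia c' ` generate W1 L" by (rule rev_subsetD)
  then show "t \<in> pull_right L" using t K_src by (auto simp: pull_right_def)
qed

lemma K_pull_left:
  assumes "K \<subseteq> L"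
  shows "conj_elt W1 w1 ` K \<subseteq> pull_left L"
proof (rule image_subsetI)
  fix t assume t: "t \<in> K"
  then have "t \<in> carrier W1" using K_src src_subset A.gens_closed by blast
  moreover have "conj_elt W1 w1 t \<in> src c'" using t stable_K by (auto simp: stable_def)
  ultimately show "conj_elt W1 w1 t \<in> pull_left L"
    using t assms by (auto simp: pull_left_def intro: generate.incl)
qed

abbreviation orbit_elt where
  "orbit_elt x v y \<equiv> (x \<cdot> w1 \<cdot> v \<cdot> y, dia c' x \<star> w2 \<star> dia c y)"

text \<open>One round of the alternation: make the second component minimal on the right, then the
  first minimal on the left. The factor v is unchanged, and the new left factor lies in the
  parabolic subgroup generated by \<open>pull_left (pull_right L)\<close>.\<close>

lemma reduces_pull:
  assumes L: "L \<subseteq> src c'" and KL: "conj_elt W1 w1 ` K \<subseteq> L"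
    and x: "x \<in> generate W1 L" and v: "v \<in> generate W1 K" and y: "y \<in> generate W1 (src c)"
  obtains x' y' where "x' \<in> generate W1 (pull_left (pull_right L))" "y' \<in> generate W1 (src c)"
    "red (orbit_elt x v y) (orbit_elt x' v y')"
proof -
  let ?R = "pull_right L"
  have LI: "L \<subseteq> I1" using L T'.src_subset by blast
  have RI: "?R \<subseteq> I1" using pull_right_src src_subset by blast
  have xs: "x \<in> generate W1 (src c')" using x A.mono_generate[OF L] by blast
  have xc: "x \<in> carrier W1" and yc: "y \<in> carrier W1"
    using T'.src_closed[OF xs] src_closed[OF y] .
  have vs: "v \<in> generate W1 (src c)" using v A.mono_generate[OF K_src] by blast
  have vc: "v \<in> carrier W1" using src_closed[OF vs] .
  have dx: "dia c' x \<in> generate W2 (dia c' ` L)" using x T'.dia_generate[OF L] by blast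
  have dL: "dia c' ` L \<subseteq> I2" using L T'.dia_gens by blast
  \<comment> \<open>The letters allowed by Deodhar's lemma in \<open>W2\<close> are exactly the
    images of \<open>pull_right L\<close>, so the emerging factor q lifts to p in
    \<open>W1\<close>.\<close>
  have R_eq: "{t \<in> tgt c. conj_elt W2 w2 t \<in> generate W2 (dia c' ` L)} = dia c ` ?R"
    using T'.dia_generate[OF L] by (auto simp: pull_right_def dia_src[symmetric])
  obtain q b where qb: "dia c' x \<star> w2 = b \<star> q" "b \<in> min_reps_right W2 I2 (tgt c)"
    "q \<in> generate W2 (dia c ` ?R)"
    by (rule B.min_reps_right_mult_parabolic[OF tgt_subset w2 dL dx, unfolded R_eq])
  obtain p where p: "p \<in> generate W1 ?R" "q = dia c p"
    using qb(3) dia_generate[OF pull_right_src] by blast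
  have ps: "p \<in> generate W1 (src c)" using p(1) A.mono_generate[OF pull_right_src] by blast
  have pc: "p \<in> carrier W1" using src_closed[OF ps] .
  have bc: "b \<in> carrier W2" using qb(2) B.mem_min_reps_right[OF tgt_subset] by blast
  have d: "dia c' x \<in> carrier W2" "dia c p \<in> carrier W2" "dia c y \<in> carrier W2"
    using T'.dia_closed[OF xs] dia_closed[OF ps] dia_closed[OF y] .
  have ip: "inv\<^bsub>W1\<^esub> p \<in> generate W1 (src c)" using src_inv[OF ps] .
  have py: "p \<cdot> y \<in> generate W1 (src c)" using ps y by (rule generate.eng)

  have "x \<cdot> w1 \<cdot> v \<cdot> y \<in> carrier W1" using xc yc vc by simp
  \<comment> \<open>As \<delta>'(x) w2 = b \<delta>(p), the whole tail p y is removed at once, which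
    also eliminates y from the first component.\<close>
  then have "red (x \<cdot> w1 \<cdot> v \<cdot> y, b \<star> dia c (p \<cdot> y)) (x \<cdot> w1 \<cdot> v \<cdot> y \<cdot> inv\<^bsub>W1\<^esub> (p \<cdot> y), b)"
    using qb(2) py by (rule reduces_right)
  moreover have "b \<star> dia c (p \<cdot> y) = dia c' x \<star> w2 \<star> dia c y"
    unfolding dia_mult[OF ps y] qb(1) p(2) using d bc by (simp add: B.m_assoc)
  moreover have "x \<cdot> w1 \<cdot> v \<cdot> y \<cdot> inv\<^bsub>W1\<^esub> (p \<cdot> y) = x \<cdot> (w1 \<cdot> (v \<cdot> inv\<^bsub>W1\<^esub> p))"
  proof -
    have "y \<cdot> (inv\<^bsub>W1\<^esub> y \<cdot> inv\<^bsub>W1\<^esub> p) = inv\<^bsub>W1\<^esub> p"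
      using yc pc by (simp add: A.m_assoc[symmetric])
    then show ?thesis using xc yc vc pc by (simp add: A.inv_mult_group A.m_assoc)
  qed
  ultimately have red1: "red (orbit_elt x v y) (x \<cdot> (w1 \<cdot> (v \<cdot> inv\<^bsub>W1\<^esub> p)), b)" by simp

  have "inv\<^bsub>W1\<^esub> p \<in> generate W1 ?R"
    by (rule subgroup.m_inv_closed[OF A.parabolic_subgroup[OF RI] p(1)])
  moreover have "v \<in> generate W1 ?R" using v A.mono_generate[OF K_pull_right[OF KL]] by blast
  ultimately have z: "v \<cdot> inv\<^bsub>W1\<^esub> p \<in> generate W1 ?R" by (intro generate.eng)
  obtain r a where ra: "w1 \<cdot> (v \<cdot> inv\<^bsub>W1\<^esub> p) = r \<cdot> a" "a \<in> min_reps_left W1 I1 (src c')"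
    "r \<in> generate W1 (pull_left ?R)"
    by (rule A.min_reps_left_mult_parabolic[OF T'.src_subset w1 RI z, folded pull_left_def])
  have PI: "pull_left ?R \<subseteq> I1" using pull_left_src T'.src_subset by blast
  have rs: "r \<in> generate W1 (src c')" using ra(3) A.mono_generate[OF pull_left_src] by blast
  have rc: "r \<in> carrier W1" using T'.src_closed[OF rs] .
  have ac: "a \<in> carrier W1" using ra(2) A.mem_min_reps_left[OF T'.src_subset] by blast
  have dr: "dia c' r \<in> carrier W2" using T'.dia_closed[OF rs] .
  \<comment> \<open>Both x and r are removed on the left. Since b = \<delta>'(x) w2 \<delta>(p)^-1,
    the contribution of x cancels in \<delta>'(x r)^-1 b, and only r^-1 and p^-1 remain as new outer
    factors.\<close>
  have xr: "x \<cdot> r \<in> generate W1 (src c')" using xs rs by (rule generate.eng)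
  have "red (x \<cdot> r \<cdot> a, b) (a, inv\<^bsub>W2\<^esub> (dia c' (x \<cdot> r)) \<star> b)"
    using bc ra(2) xr by (rule reduces_left)
  moreover have "x \<cdot> r \<cdot> a = x \<cdot> (w1 \<cdot> (v \<cdot> inv\<^bsub>W1\<^esub> p))"
    unfolding ra(1) using xc rc ac by (simp add: A.m_assoc)
  moreover have "a = inv\<^bsub>W1\<^esub> r \<cdot> w1 \<cdot> v \<cdot> inv\<^bsub>W1\<^esub> p"
  proof -
    have "inv\<^bsub>W1\<^esub> r \<cdot> (w1 \<cdot> (v \<cdot> inv\<^bsub>W1\<^esub> p)) = a"
      unfolding ra(1) using rc ac by (simp add: A.m_assoc[symmetric])
    then show ?thesis using rc vc pc by (simp add: A.m_assoc)
  qed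
  moreover have "inv\<^bsub>W2\<^esub> (dia c' (x \<cdot> r)) \<star> b = dia c' (inv\<^bsub>W1\<^esub> r) \<star> w2 \<star> dia c (inv\<^bsub>W1\<^esub> p)"
  proof -
    have "b = dia c' x \<star> w2 \<star> inv\<^bsub>W2\<^esub> (dia c p)"
      unfolding qb(1) p(2) using bc d by (simp add: B.m_assoc)
    then have "inv\<^bsub>W2\<^esub> (dia c' x) \<star> b = w2 \<star> inv\<^bsub>W2\<^esub> (dia c p)"
      using d by (simp add: B.m_assoc[symmetric])
    then show ?thesis
      using d dr bc T'.dia_mult[OF xs rs] T'.dia_inv[OF rs] dia_inv[OF ps]
      by (simp add: B.inv_mult_group B.m_assoc)
  qed
  ultimately have "red (x \<cdot> (w1 \<cdot> (v \<cdot> inv\<^bsub>W1\<^esub> p)), b) (orbit_elt (inv\<^bsub>W1\<^esub> r) v (inv\<^bsub>W1\<^esub> p))" by simp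
  then have "red (orbit_elt x v y) (orbit_elt (inv\<^bsub>W1\<^esub> r) v (inv\<^bsub>W1\<^esub> p))"
    using red1 unfolding reduces_to_def by simp
  moreover have "inv\<^bsub>W1\<^esub> r \<in> generate W1 (pull_left ?R)"
    by (rule subgroup.m_inv_closed[OF A.parabolic_subgroup[OF PI] ra(3)])
  ultimately show thesis using that ip by blast
qed

text \<open>Crossing \<open>w1\<close> gives card L \<le> card (\<open>pull_right L\<close>),
  crossing \<open>w2\<close> gives the reverse inequality; the equality case of the rank lemma turns
  both inclusions into bijections between simple reflections.\<close>

lemma pull_fixpoint:
  assumes L: "L \<subseteq> src c'" and fix_L: "pull_left (pull_right L) = L"
  shows "conj_elt W1 w1 ` pull_right L = L"
    and "conj_elt W2 w2 ` dia c ` pull_right L = dia c' ` L"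
proof -
  let ?R = "pull_right L"
  have RI: "?R \<subseteq> I1" using pull_right_src src_subset by blast
  have "conj_elt W1 (inv\<^bsub>W1\<^esub> w1) ` L \<subseteq> generate W1 ?R"
    using fix_L unfolding pull_left_def by blast
  note rank1 = A.min_reps_left_rank[OF T'.src_subset w1 RI L this]
  have iw2: "inv\<^bsub>W2\<^esub> w2 \<in> min_reps_left W2 I2 (tgt c)"
    using w2 B.mem_min_reps_right[OF tgt_subset] by blast
  have dR: "dia c ` ?R \<subseteq> tgt c" using pull_right_src dia_src by blast
  have dL: "dia c' ` L \<subseteq> I2" using L T'.dia_gens by blast
  have "conj_elt W2 w2 ` dia c ` ?R \<subseteq> generate W2 (dia c' ` L)"
    unfolding T'.dia_generate[OF L, symmetric] by (auto simp: pull_right_def)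
  then have "conj_elt W2 (inv\<^bsub>W2\<^esub> (inv\<^bsub>W2\<^esub> w2)) ` dia c ` ?R \<subseteq> generate W2 (dia c' ` L)" by simp
  note rank2 = B.min_reps_left_rank[OF tgt_subset iw2 dL dR this]
  have "inj_on (dia c) ?R" "inj_on (dia c') L"
    using inj_on_subset[OF dia_inj] inj_on_subset[OF T'.dia_inj] L pull_right_src
    by (meson generate.incl subset_iff)+
  then have "card (dia c ` ?R) = card ?R" "card (dia c' ` L) = card L" by (simp_all add: card_image)
  then have "card L = card ?R" using rank1(1) rank2(1) by simp
  then have eq: "conj_elt W1 (inv\<^bsub>W1\<^esub> w1) ` L = ?R" "conj_elt W2 w2 ` dia c ` ?R = dia c' ` L"
    using rank1(2) rank2(2) \<open>card (dia c ` ?R) = card ?R\<close> \<open>card (dia c' ` L) = card L\<close> by auto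
  have "L \<subseteq> carrier W1" using L T'.src_subset A.gens_closed by blast
  then show "conj_elt W1 w1 ` ?R = L" unfolding eq(1)[symmetric] by (force simp: image_image)
  show "conj_elt W2 w2 ` dia c ` ?R = dia c' ` L" by (rule eq(2))
qed

text \<open>Induction on the size of \<open>L\<close>. As long as the sequence strictly decreases,
  \<open>reduces_pull\<close> applies with the same v; once it is stationary, x is absorbed into
  v.\<close>

lemma reduces_to_stable:
  assumes "L \<subseteq> src c'" "conj_elt W1 w1 ` K \<subseteq> L" "pull_left (pull_right L) \<subseteq> L"
    and "x \<in> generate W1 L" "v \<in> generate W1 K" "y \<in> generate W1 (src c)"
  shows "\<exists>v'\<in>generate W1 K. red (orbit_elt x v y) (w1 \<cdot> v', w2)"
  using assms
proof (induction "card L" arbitrary: L x y rule: less_induct)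
  case less
  let ?R = "pull_right L"
  show ?case
  proof (cases "pull_left ?R = L")
    case False
    obtain x' y' where xy: "x' \<in> generate W1 (pull_left ?R)" "y' \<in> generate W1 (src c)"
      "red (orbit_elt x v y) (orbit_elt x' v y')"
      by (rule reduces_pull[OF less.prems(1,2,4,5,6)])
    have "finite L"
      using less.prems(1) T'.src_subset A.finite_gens by (meson finite_subset)
    then have "card (pull_left ?R) < card L"
      using False less.prems(3) by (intro psubset_card_mono) auto
    moreover have "conj_elt W1 w1 ` K \<subseteq> pull_left ?R"
      by (intro K_pull_left K_pull_right less.prems)
    ultimately obtain v' where v': "v' \<in> generate W1 K" "red (orbit_elt x' v y') (w1 \<cdot> v', w2)"
      using less.hyps[of "pull_left ?R" x' y'] pull_left_src pull_mono[OF less.prems(3)] xy(1,2)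
        less.prems(5) by blast
    have "red (orbit_elt x v y) (w1 \<cdot> v', w2)"
      using xy(3) v'(2) unfolding reduces_to_def by (rule rtranclp_trans)
    then show ?thesis using v'(1) by blast
  next
    case True
    note fixpoint = pull_fixpoint[OF less.prems(1) True]
    have "stable ?R"
      using fixpoint pull_right_src less.prems(1) by (simp add: stable_def)
    then have RK: "?R \<subseteq> K" by (rule stable_subset_K)
    have RG: "?R \<subseteq> carrier W1" using pull_right_src src_subset A.gens_closed by blast
    have KI: "K \<subseteq> I1" using K_src src_subset by blast
    have genL: "generate W1 L = conj_elt W1 w1 ` generate W1 ?R"
      using A.conj_elt_generate[of w1 ?R] RG fixpoint(1) by simp
    obtain u where u: "u \<in> generate W1 ?R" "x = conj_elt W1 w1 u"
      using less.prems(4) genL by blast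
    have dRG: "dia c ` ?R \<subseteq> carrier W2" using pull_right_src dia_gens B.gens_closed by blast
    have "dia c' ` generate W1 L = conj_elt W2 w2 ` dia c ` generate W1 ?R"
      using B.conj_elt_generate[of w2 "dia c ` ?R"] dRG fixpoint(2)
        T'.dia_generate[OF less.prems(1)] dia_generate[OF pull_right_src] by simp
    \<comment> \<open>By definition of the twist, z is \<sigma>(u), so the final element u v z^-1 is
      a \<sigma>-twisted conjugate of v.\<close>
    then obtain z where z: "z \<in> generate W1 ?R" "dia c' x = conj_elt W2 w2 (dia c z)"
      using less.prems(4) by blast
    have zs: "z \<in> generate W1 (src c)" using z(1) A.mono_generate[OF pull_right_src] by blast
    have zK: "z \<in> generate W1 K" and uK: "u \<in> generate W1 K"
      using z(1) u(1) A.mono_generate[OF RK] by auto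
    have y: "y \<in> generate W1 (src c)" by (rule less.prems(6))
    have zy: "z \<cdot> y \<in> generate W1 (src c)" using zs y by (rule generate.eng)
    have cl: "z \<in> carrier W1" "u \<in> carrier W1" "v \<in> carrier W1" "y \<in> carrier W1"
      using A.parabolic_closed[OF KI] zK uK less.prems(5) src_closed[OF y] by auto
    have d: "dia c z \<in> carrier W2" "dia c y \<in> carrier W2" using dia_closed zs y by auto
    have "w1 \<cdot> u \<cdot> v \<cdot> y \<in> carrier W1" using cl by simp
    then have "red (w1 \<cdot> u \<cdot> v \<cdot> y, w2 \<star> dia c (z \<cdot> y)) (w1 \<cdot> u \<cdot> v \<cdot> y \<cdot> inv\<^bsub>W1\<^esub> (z \<cdot> y), w2)"
      using w2 zy by (rule reduces_right)
    moreover have "w1 \<cdot> u \<cdot> v \<cdot> y = x \<cdot> w1 \<cdot> v \<cdot> y"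
    proof -
      have "x \<cdot> w1 = w1 \<cdot> u" using u(2) cl by (simp add: conj_elt_def A.m_assoc)
      then show ?thesis by simp
    qed
    moreover have "w2 \<star> dia c (z \<cdot> y) = dia c' x \<star> w2 \<star> dia c y"
    proof -
      have "dia c' x \<star> w2 = w2 \<star> dia c z" using z(2) d by (simp add: conj_elt_def B.m_assoc)
      then show ?thesis using dia_mult[OF zs y] d by (simp add: B.m_assoc)
    qed
    moreover have "w1 \<cdot> u \<cdot> v \<cdot> y \<cdot> inv\<^bsub>W1\<^esub> (z \<cdot> y) = w1 \<cdot> (u \<cdot> v \<cdot> inv\<^bsub>W1\<^esub> z)"
    proof -
      have "y \<cdot> (inv\<^bsub>W1\<^esub> y \<cdot> inv\<^bsub>W1\<^esub> z) = inv\<^bsub>W1\<^esub> z"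
        using cl by (simp add: A.m_assoc[symmetric])
      then show ?thesis using cl by (simp add: A.inv_mult_group A.m_assoc)
    qed
    ultimately have "red (orbit_elt x v y) (w1 \<cdot> (u \<cdot> v \<cdot> inv\<^bsub>W1\<^esub> z), w2)" by simp
    moreover have "u \<cdot> v \<cdot> inv\<^bsub>W1\<^esub> z \<in> generate W1 K"
      by (intro generate.eng uK less.prems(5) subgroup.m_inv_closed[OF A.parabolic_subgroup[OF KI] zK])
    ultimately show ?thesis by blast
  qed
qed

lemma orbit_elt_reduces:
  assumes "x \<in> generate W1 (src c')" "v \<in> generate W1 K" "y \<in> generate W1 (src c)"
  shows "\<exists>v'\<in>generate W1 K. red (orbit_elt x v y) (w1 \<cdot> v', w2)"
  using stable_K assms by (intro reduces_to_stable[of "src c'"]) (auto simp: stable_def pull_left_def)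

text \<open>Minimality of \<open>w1\<close> is available only on its left. Rewriting w1 v as (w1 v
  w1^-1) w1 brings the parabolic factor to that side, and conjugation preserves its length.\<close>

lemma len_stable:
  assumes v: "v \<in> generate W1 K"
  shows "A.len (w1 \<cdot> v) = A.len w1 + A.len v"
proof -
  have KI: "K \<subseteq> I1" using K_src src_subset by blast
  have KG: "K \<subseteq> carrier W1" using KI A.gens_closed by blast
  have vc: "v \<in> carrier W1" using A.parabolic_closed[OF KI v] .
  have wK: "conj_elt W1 w1 ` K \<subseteq> src c'" using stable_K by (simp add: stable_def)
  have "conj_elt W1 w1 v \<in> generate W1 (conj_elt W1 w1 ` K)"
    using v A.conj_elt_generate[OF w1_closed KG] by blast
  then have "conj_elt W1 w1 v \<in> generate W1 (src c')" using A.mono_generate[OF wK] by blast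
  then have "A.len (conj_elt W1 w1 v \<cdot> w1) = A.len (conj_elt W1 w1 v) + A.len w1"
    by (rule A.len_parabolic_mult[OF T'.src_subset w1])
  moreover have "conj_elt W1 w1 v \<cdot> w1 = w1 \<cdot> v" using vc by (simp add: conj_elt_def A.m_assoc)
  moreover have "A.len (conj_elt W1 w1 v) = A.len v"
    using wK T'.src_subset by (intro A.len_conj_elt[OF w1_closed KI _ v]) blast
  ultimately show ?thesis by simp
qed

end


section \<open>Double cosets as orbits\<close>

text \<open>Each component changes length by exactly one, so with equal total length one grows and
  the other shrinks. Multiplying only the growing component adds one, the length of the letter; this
  decides which alternative holds.\<close>

lemma (in admissible_pair) strong_conj_of_equal_length:
  assumes "elementary_reduction W1 I1 W2 I2 c c' w w'" and len: "plen w' = plen w"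
  shows "elementary_strong_conj W1 I1 W2 I2 c c' w w'"
  using assms(1)
proof cases
  case (left i)
  obtain a b where w': "w' = (a, b)" by force
  have ab: "a \<in> carrier W1" "b \<in> carrier W2" using left w' by auto
  have iI: "i \<in> I1" and dI: "dia c' i \<in> I2"
    using left T'.src_subset T'.dia_gens by auto
  have ic: "i \<in> carrier W1" "dia c' i \<in> carrier W2"
    using iI dI A.gens_in_carrier B.gens_in_carrier by auto
  have w: "w = (i \<cdot> a, dia c' i \<star> b)" using left w' by simp
  have cancel: "i \<cdot> (i \<cdot> a) = a" "dia c' i \<star> (dia c' i \<star> b) = b"
    using A.gens_cancel[OF iI ab(1)] B.gens_cancel[OF dI ab(2)] by auto
  show ?thesis
  \<comment> \<open>The letter is an involution, so the pair relating \<open>w'\<close> to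
    \<open>w\<close> also leads from \<open>w\<close> to \<open>w'\<close>.\<close>
  proof (rule elementary_strong_conj.intros[where x = i and y = "\<one>\<^bsub>W1\<^esub>"])
    show "w \<in> carrier (W1 \<times>\<times> W2)" "i \<in> generate W1 (src c')" "\<one>\<^bsub>W1\<^esub> \<in> generate W1 (src c)"
      using w ab ic left by (auto intro: generate.incl generate.one)
    show "plen w' = plen w" by (rule len)
    show "w' = (i, dia c' i) \<otimes>\<^bsub>W1 \<times>\<times> W2\<^esub> w \<otimes>\<^bsub>W1 \<times>\<times> W2\<^esub> (\<one>\<^bsub>W1\<^esub>, dia c \<one>\<^bsub>W1\<^esub>)"
      using w w' ab ic cancel by simp
    show "plen ((i, \<one>\<^bsub>W2\<^esub>) \<otimes>\<^bsub>W1 \<times>\<times> W2\<^esub> w \<otimes>\<^bsub>W1 \<times>\<times> W2\<^esub> (\<one>\<^bsub>W1\<^esub>, dia c \<one>\<^bsub>W1\<^esub>)) =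
        A.len i + plen w + A.len \<one>\<^bsub>W1\<^esub> \<or>
      plen ((\<one>\<^bsub>W1\<^esub>, dia c' i) \<otimes>\<^bsub>W1 \<times>\<times> W2\<^esub> w \<otimes>\<^bsub>W1 \<times>\<times> W2\<^esub> (\<one>\<^bsub>W1\<^esub>, \<one>\<^bsub>W2\<^esub>)) =
        A.len i + plen w + A.len \<one>\<^bsub>W1\<^esub>"
      using w w' ab ic cancel len A.len_gen[OF iI] A.len_gen_mult[OF iI ab(1)]
      by (auto simp: prod_length_def)
  qed
next
  case (right j)
  obtain a b where w': "w' = (a, b)" by force
  have ab: "a \<in> carrier W1" "b \<in> carrier W2" using right w' by auto
  have jI: "j \<in> I1" and dI: "dia c j \<in> I2"
    using right src_subset dia_gens by auto
  have jc: "j \<in> carrier W1" "dia c j \<in> carrier W2"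
    using jI dI A.gens_in_carrier B.gens_in_carrier by auto
  have w: "w = (a \<cdot> j, b \<star> dia c j)" using right w' by simp
  have cancel: "a \<cdot> j \<cdot> j = a" "b \<star> dia c j \<star> dia c j = b"
    using A.gens_square[OF jI] B.gens_square[OF dI] ab jc by (simp_all add: A.m_assoc B.m_assoc)
  show ?thesis
  proof (rule elementary_strong_conj.intros[where x = "\<one>\<^bsub>W1\<^esub>" and y = j])
    show "w \<in> carrier (W1 \<times>\<times> W2)" "j \<in> generate W1 (src c)" "\<one>\<^bsub>W1\<^esub> \<in> generate W1 (src c')"
      using w ab jc right by (auto intro: generate.incl generate.one)
    show "plen w' = plen w" by (rule len)
    show "w' = (\<one>\<^bsub>W1\<^esub>, dia c' \<one>\<^bsub>W1\<^esub>) \<otimes>\<^bsub>W1 \<times>\<times> W2\<^esub> w \<otimes>\<^bsub>W1 \<times>\<times> W2\<^esub> (j, dia c j)"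
      using w w' ab jc cancel by simp
    show "plen ((\<one>\<^bsub>W1\<^esub>, \<one>\<^bsub>W2\<^esub>) \<otimes>\<^bsub>W1 \<times>\<times> W2\<^esub> w \<otimes>\<^bsub>W1 \<times>\<times> W2\<^esub> (\<one>\<^bsub>W1\<^esub>, dia c j)) =
        A.len \<one>\<^bsub>W1\<^esub> + plen w + A.len j \<or>
      plen ((\<one>\<^bsub>W1\<^esub>, dia c' \<one>\<^bsub>W1\<^esub>) \<otimes>\<^bsub>W1 \<times>\<times> W2\<^esub> w \<otimes>\<^bsub>W1 \<times>\<times> W2\<^esub> (j, \<one>\<^bsub>W2\<^esub>)) =
        A.len \<one>\<^bsub>W1\<^esub> + plen w + A.len j"
      using w w' ab jc cancel len A.len_gen[OF jI] A.len_mult_gen[OF jI ab(1)]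
      by (auto simp: prod_length_def)
  qed
qed

text \<open>Reductions never increase length and stay in \<open>X\<close>, so from a minimal element
  every step has constant length and is a strong conjugation.\<close>

lemma (in admissible_pair) strongly_conj_of_minimal:
  assumes closed: "\<And>w w'. \<lbrakk>w \<in> X; elementary_reduction W1 I1 W2 I2 c c' w w'\<rbrakk> \<Longrightarrow> w' \<in> X"
    and w: "w \<in> minimal_elements plen X" and red: "red w w'"
  shows "w' \<in> minimal_elements plen X \<and> strongly_conj W1 I1 W2 I2 c c' w w'"
  using red unfolding reduces_to_def
proof (induction rule: rtranclp_induct)
  case base
  then show ?case using w by (simp add: strongly_conj_def)
next
  case (step y z)
  have y: "y \<in> X" "\<And>u. u \<in> X \<Longrightarrow> plen y \<le> plen u"
    using step.IH by (auto simp: minimal_elements_def)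
  have z: "z \<in> X" using closed y(1) step.hyps(2) by blast
  have "plen z \<le> plen y" using step.hyps(2) by cases auto
  then have len: "plen z = plen y" using y(2)[OF z] by simp
  then have "elementary_strong_conj W1 I1 W2 I2 c c' y z"
    using step.hyps(2) strong_conj_of_equal_length by blast
  moreover have "z \<in> minimal_elements plen X"
    using y z len by (simp add: minimal_elements_def)
  ultimately show ?case using step.IH by (auto simp: strongly_conj_def)
qed

section \<open>Double cosets as orbits under the two graph subgroups\<close>

context piece_pair
begin

text \<open>The double coset of (w1 v, w2), parametrised in the form treated by
  \<open>orbit_elt_reduces\<close>.\<close>

definition orbit :: "'a \<Rightarrow> ('a \<times> 'b) set" where
  "orbit v = {orbit_elt x v y | x y. x \<in> generate W1 (src c') \<and> y \<in> generate W1 (src c)}"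

lemma elementary_reduction_orbit:
  assumes w: "w \<in> orbit v" and v: "v \<in> generate W1 K"
    and red: "elementary_reduction W1 I1 W2 I2 c c' w w'"
  shows "w' \<in> orbit v"
proof -
  have KI: "K \<subseteq> I1" using K_src src_subset by blast
  have vc: "v \<in> carrier W1" using A.parabolic_closed[OF KI v] .
  obtain x y where xy: "x \<in> generate W1 (src c')" "y \<in> generate W1 (src c)" "w = orbit_elt x v y"
    using w by (auto simp: orbit_def)
  have cl: "x \<in> carrier W1" "y \<in> carrier W1" "dia c' x \<in> carrier W2" "dia c y \<in> carrier W2"
    using T'.src_closed src_closed T'.dia_closed dia_closed xy by auto
  obtain a b where ab: "w' = (a, b)" by force
  show ?thesis
    using red
  proof cases
    case (left i)
    have abc: "a \<in> carrier W1" "b \<in> carrier W2" using left ab by auto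
    have iI: "i \<in> I1" and dI: "dia c' i \<in> I2" using left T'.src_subset T'.dia_gens by auto
    have ig: "i \<in> generate W1 (src c')" using left by (intro generate.incl)
    have ic: "i \<in> carrier W1" "dia c' i \<in> carrier W2"
      using iI dI A.gens_in_carrier B.gens_in_carrier by auto
    have e: "i \<cdot> a = x \<cdot> w1 \<cdot> v \<cdot> y" "dia c' i \<star> b = dia c' x \<star> w2 \<star> dia c y"
      using left ab xy(3) by auto
    have "a = i \<cdot> (x \<cdot> w1 \<cdot> v \<cdot> y)" "b = dia c' i \<star> (dia c' x \<star> w2 \<star> dia c y)"
      using A.gens_cancel[OF iI abc(1)] B.gens_cancel[OF dI abc(2)] e by auto
    then have "w' = orbit_elt (i \<cdot> x) v y"
      using ab cl ic vc T'.dia_mult[OF ig xy(1)] by (simp add: A.m_assoc B.m_assoc)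
    then show ?thesis using generate.eng[OF ig xy(1)] xy(2) unfolding orbit_def by blast
  next
    case (right j)
    have abc: "a \<in> carrier W1" "b \<in> carrier W2" using right ab by auto
    have jI: "j \<in> I1" and dI: "dia c j \<in> I2" using right src_subset dia_gens by auto
    have jg: "j \<in> generate W1 (src c)" using right by (intro generate.incl)
    have jc: "j \<in> carrier W1" "dia c j \<in> carrier W2"
      using jI dI A.gens_in_carrier B.gens_in_carrier by auto
    have e: "a \<cdot> j = x \<cdot> w1 \<cdot> v \<cdot> y" "b \<star> dia c j = dia c' x \<star> w2 \<star> dia c y"
      using right ab xy(3) by auto
    have "a = a \<cdot> j \<cdot> j" "b = b \<star> dia c j \<star> dia c j"
      using A.gens_square[OF jI] B.gens_square[OF dI] abc jc by (simp_all add: A.m_assoc B.m_assoc)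
    then have "w' = orbit_elt x v (y \<cdot> j)"
      unfolding e using ab cl jc vc dia_mult[OF xy(2) jg] by (simp add: A.m_assoc B.m_assoc)
    then show ?thesis using generate.eng[OF xy(2) jg] xy(1) unfolding orbit_def by blast
  qed
qed

text \<open>A representative taken from the piece already carries outer factors x0 and y0;
  translating the parameters by them leaves an element v of the stable parabolic subgroup.\<close>

lemma double_coset_eq_orbit:
  assumes "X \<in> double_cosets (W1 \<times>\<times> W2) (graph_subgroup W1 c') (piece W1 W2 w1 w2 c c')
    (graph_subgroup W1 c)"
  obtains v where "v \<in> generate W1 K" "X = orbit v"
proof -
  obtain z where z: "z \<in> piece W1 W2 w1 w2 c c'"
    and X: "X = graph_subgroup W1 c' <#>\<^bsub>W1 \<times>\<times> W2\<^esub> {z} <#>\<^bsub>W1 \<times>\<times> W2\<^esub> graph_subgroup W1 c"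
    using assms by (auto simp: double_cosets_def)
  obtain x0 v y0 where z0: "x0 \<in> generate W1 (src c')" "v \<in> generate W1 K"
      "y0 \<in> generate W1 (src c)"
    and z_eq: "z = (x0 \<cdot> (w1 \<cdot> v) \<cdot> y0, dia c' x0 \<star> w2 \<star> dia c y0)"
    using z by (auto simp: piece_def set_mult_def graph_subgroup_def l_coset_def stable_parabolic_def)
  have KI: "K \<subseteq> I1" using K_src src_subset by blast
  have vc: "v \<in> carrier W1" using A.parabolic_closed[OF KI z0(2)] .
  have c0: "x0 \<in> carrier W1" "y0 \<in> carrier W1" "dia c' x0 \<in> carrier W2" "dia c y0 \<in> carrier W2"
    using T'.src_closed src_closed T'.dia_closed dia_closed z0 by auto
  have elt: "(x, dia c' x) \<otimes>\<^bsub>W1 \<times>\<times> W2\<^esub> z \<otimes>\<^bsub>W1 \<times>\<times> W2\<^esub> (y, dia c y) = orbit_elt (x \<cdot> x0) v (y0 \<cdot> y)"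
    if "x \<in> generate W1 (src c')" "y \<in> generate W1 (src c)" for x y
  proof -
    have "x \<in> carrier W1" "y \<in> carrier W1" "dia c' x \<in> carrier W2" "dia c y \<in> carrier W2"
      using T'.src_closed src_closed T'.dia_closed dia_closed that by auto
    then show ?thesis
      using z_eq c0 vc T'.dia_mult[OF that(1) z0(1)] dia_mult[OF z0(3) that(2)]
      by (simp add: A.m_assoc B.m_assoc)
  qed
  have "X = orbit v"
  proof
    show "X \<subseteq> orbit v"
    proof
      fix p assume "p \<in> X"
      then obtain x y where xy: "x \<in> generate W1 (src c')" "y \<in> generate W1 (src c)"
        and "p = (x, dia c' x) \<otimes>\<^bsub>W1 \<times>\<times> W2\<^esub> z \<otimes>\<^bsub>W1 \<times>\<times> W2\<^esub> (y, dia c y)"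
        by (auto simp: X set_mult_def graph_subgroup_def)
      then have "p = orbit_elt (x \<cdot> x0) v (y0 \<cdot> y)" using elt by metis
      then show "p \<in> orbit v"
        using generate.eng[OF xy(1) z0(1)] generate.eng[OF z0(3) xy(2)] unfolding orbit_def by blast
    qed
    show "orbit v \<subseteq> X"
    proof
      fix p assume "p \<in> orbit v"
      then obtain x y where xy: "x \<in> generate W1 (src c')" "y \<in> generate W1 (src c)"
        and p: "p = orbit_elt x v y" by (auto simp: orbit_def)
      define x' y' where "x' = x \<cdot> inv\<^bsub>W1\<^esub> x0" and "y' = inv\<^bsub>W1\<^esub> y0 \<cdot> y"
      have x': "x' \<in> generate W1 (src c')"
        unfolding x'_def by (intro generate.eng xy(1) T'.src_inv z0(1))
      have y': "y' \<in> generate W1 (src c)"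
        unfolding y'_def by (intro generate.eng xy(2) src_inv z0(3))
      have "x' \<cdot> x0 = x"
        using T'.src_closed[OF xy(1)] c0 by (simp add: x'_def A.m_assoc)
      moreover have "y0 \<cdot> y' = y"
        using src_closed[OF xy(2)] c0 by (simp add: y'_def A.m_assoc[symmetric])
      ultimately have "p = (x', dia c' x') \<otimes>\<^bsub>W1 \<times>\<times> W2\<^esub> z \<otimes>\<^bsub>W1 \<times>\<times> W2\<^esub> (y', dia c y')"
        using elt[OF x' y'] p by simp
      moreover have "(x', dia c' x') \<in> graph_subgroup W1 c'" "(y', dia c y') \<in> graph_subgroup W1 c"
        using x' y' by (auto simp: graph_subgroup_def)
      ultimately show "p \<in> X" unfolding X set_mult_def by blast
    qed
  qed
  with z0(2) show thesis by (rule that)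
qed

lemma reduces_to_orbit:
  assumes "w \<in> orbit v" "v \<in> generate W1 K" "red w w'"
  shows "w' \<in> orbit v"
  using assms(3,1) unfolding reduces_to_def
  by (induction rule: rtranclp_induct) (use assms(2) elementary_reduction_orbit in auto)

end

section \<open>Reduction inside the double coset and comparison of minimal lengths\<close>

theorem proposition3p4:
  fixes W1 :: "('a, 'm) monoid_scheme" and I1 :: "'a set"
    and W2 :: "('b, 'n) monoid_scheme" and I2 :: "'b set"
    and c c' :: "('a, 'b) triple"
    and w1 :: 'a and w2 :: 'b
    and \<O> :: "('a \<times> 'b) set" and \<O>' :: "'a set"
  assumes "coxeter_group W1 I1"
    and "coxeter_group W2 I2"
    and "admissible_triple W1 I1 W2 I2 c"
    and "admissible_triple W1 I1 W2 I2 c'"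
    and "w1 \<in> min_reps_left W1 I1 (src c')"
    and "w2 \<in> min_reps_right W2 I2 (tgt c)"
    and "\<O> \<in> double_cosets (W1 \<times>\<times> W2) (graph_subgroup W1 c') (piece W1 W2 w1 w2 c c') (graph_subgroup W1 c)"
    and "\<O>' \<in> twisted_classes W1 (stable_parabolic W1 W2 w1 w2 c c') (twist W1 W2 w1 w2 c c')"
    and "\<O>' = {v \<in> stable_parabolic W1 W2 w1 w2 c c'. (w1 \<otimes>\<^bsub>W1\<^esub> v, w2) \<in> \<O>}"
  shows "(\<forall>w \<in> \<O>. \<exists>v \<in> \<O>'. reduces_to W1 I1 W2 I2 c c' w (w1 \<otimes>\<^bsub>W1\<^esub> v, w2)) \<and>
    (\<forall>w \<in> minimal_elements (prod_length W1 I1 W2 I2) \<O>.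
      \<exists>v \<in> minimal_elements (cox_length W1 I1) \<O>'.
        approx_conj W1 I1 W2 I2 c c' w (w1 \<otimes>\<^bsub>W1\<^esub> v, w2))"
proof -
  interpret coxeter_group W1 I1 by fact
  interpret W2: coxeter_group W2 I2 by fact
  interpret piece_pair W1 I1 W2 I2 c c' w1 w2
    by unfold_locales (use assms in auto)
  obtain u where u: "u \<in> generate W1 K" and \<O>: "\<O> = orbit u"
    by (rule double_coset_eq_orbit[OF assms(7)])
  have \<O>': "\<O>' = {v \<in> generate W1 K. (w1 \<cdot> v, w2) \<in> \<O>}"
    using assms(9) by (simp add: stable_parabolic_def)
  have reduction: "\<exists>v\<in>\<O>'. red w (w1 \<cdot> v, w2)" if w: "w \<in> \<O>" for w
  proof -
    obtain x y where "x \<in> generate W1 (src c')" "y \<in> generate W1 (src c)" "w = orbit_elt x u y"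
      using w \<O> by (auto simp: orbit_def)
    then obtain v where v: "v \<in> generate W1 K" "red w (w1 \<cdot> v, w2)"
      using orbit_elt_reduces[OF _ u] by blast
    \<comment> \<open>Reductions do not leave the double coset, which places v in \<O>'.\<close>
    have "(w1 \<cdot> v, w2) \<in> \<O>" using reduces_to_orbit[OF _ u v(2)] w \<O> by simp
    then show ?thesis using v \<O>' by blast
  qed
  moreover have "\<exists>v\<in>minimal_elements (cox_length W1 I1) \<O>'. approx_conj W1 I1 W2 I2 c c' w (w1 \<cdot> v, w2)"
    if w: "w \<in> minimal_elements plen \<O>" for w
  proof -
    have "w \<in> \<O>" using w by (simp add: minimal_elements_def)
    then obtain v where v: "v \<in> \<O>'" "red w (w1 \<cdot> v, w2)" using reduction by blast
    have min: "(w1 \<cdot> v, w2) \<in> minimal_elements plen \<O>"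
      and conj: "strongly_conj W1 I1 W2 I2 c c' w (w1 \<cdot> v, w2)"
      using strongly_conj_of_minimal[OF _ w v(2)] elementary_reduction_orbit[OF _ u] \<O> by blast+
    \<comment> \<open>The pairs share the second component \<open>w2\<close>, and their first
      components have lengths l(w1) + l(v) and l(w1) + l(v'), so total length compares v with
      v'.\<close>
    have "cox_length W1 I1 v \<le> cox_length W1 I1 v'" if "v' \<in> \<O>'" for v'
    proof -
      have "plen (w1 \<cdot> v, w2) \<le> plen (w1 \<cdot> v', w2)"
        using min that \<O>' by (simp add: minimal_elements_def)
      then show ?thesis using len_stable v(1) that \<O>' by (simp add: prod_length_def)
    qed
    then have "v \<in> minimal_elements (cox_length W1 I1) \<O>'"
      using v(1) by (simp add: minimal_elements_def)
    then show ?thesis using v(2) conj by (auto simp: approx_conj_def)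
  qed
  ultimately show ?thesis by blast
qed

end
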